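(* There is a closed commutative ${}^*$-subalgebra of $\mathcal{L}(s',s)$ which is not isomorphic as a Fr\'echet ${}^*$-algebra to any closed ${}^*$-subalgebra of $s$.
   Context: $\mathbb{N}=\{1,2,\dots\}$, $\mathbb{N}_0=\mathbb{N}\cup\{0\}$; all spaces are over $\mathbb{C}$. A Fr\'echet ${}^*$-algebra is a Fr\'echet space (complete metrizable locally convex space) that is an algebra with continuous multiplication and continuous involution; an isomorphism of Fr\'echet ${}^*$-algebras is an algebra ${}^*$-isomorphism that is also a homeomorphism. The space $s$: $s=\{\xi=(\xi_j)_{j\in\mathbb{N}}\in\mathbb{C}^{\mathbb{N}}:|\xi|_q:=(\sum_{j=1}^\infty|\xi_j|^2j^{2q})^{1/2}<\infty\text{ for all }q\in\mathbb{N}_0\}$, with the topology of the norms $(|\cdot|_q)_{q\in\mathbb{N}_0}$; it is a Fr\'echet ${}^*$-algebra with pointwise multiplication and pointwise complex conjugation. Its strong dual is identified with $s'=\{\xi\in\mathbb{C}^{\mathbb{N}}:|\xi|_q':=(\sum_{j=1}^\infty|\xi_j|^2j^{-2q})^{1/2}<\infty\text{ for some }q\in\mathbb{N}_0\}$ (with inductive limit topology) via $\langle\xi,\eta\rangle=\sum_j\xi_j\overline{\eta_j}$. The algebra $\mathcal{L}(s',s)$: all continuous linear operators $s'\to s$, with the topology of uniform convergence on bounded sets of $s'$, given by the norms $\|x\|_q:=\sup_{|\xi|_q'\leq1}|x\xi|_q$, $q\in\mathbb{N}_0$. Since $s\subset\ell_2\subset s'$ continuously and densely, each $x\in\mathcal{L}(s',s)$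 is identified with the bounded operator on $\ell_2$ it induces; multiplication is composition and the involution is the Hilbert space adjoint. With these operations $\mathcal{L}(s',s)$ is a Fr\'echet ${}^*$-algebra. *)

theory Defs
  imports "HOL-Analysis.Analysis" "HOL-Library.Function_Algebras"
begin

text \<open>The types of sequences and of operators are function types, which carry pointwise addition
  (for sequences, also pointwise multiplication) from \<^theory>\<open>HOL-Library.Function_Algebras\<close>.\<close>

section \<open>Locally convex topologies given by seminorms\<close>

definition seminorm_topology :: "'a::ab_group_add set \<Rightarrow> ('a \<Rightarrow> real) set \<Rightarrow> 'a topology" where
  "seminorm_topology X P = topology (\<lambda>U. U \<subseteq> X \<and>
     (\<forall>x\<in>U. \<exists>F e. finite F \<and> F \<subseteq> P \<and> e > 0 \<and> {y \<in> X. \<forall>p\<in>F. p (y - x) < e} \<subseteq> U))"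

lemma openin_seminorm_topology:
  "openin (seminorm_topology X P) U \<longleftrightarrow> U \<subseteq> X \<and>
     (\<forall>x\<in>U. \<exists>F e. finite F \<and> F \<subseteq> P \<and> e > 0 \<and> {y \<in> X. \<forall>p\<in>F. p (y - x) < e} \<subseteq> U)"
proof -
  define N where "N F e x = {y \<in> X. \<forall>p\<in>F. p (y - x) < e}" for F :: "('a \<Rightarrow> real) set" and e x
  define L where "L U \<longleftrightarrow> U \<subseteq> X \<and> (\<forall>x\<in>U. \<exists>F e. finite F \<and> F \<subseteq> P \<and> e > 0 \<and> N F e x \<subseteq> U)" for U
  have "L (S \<inter> T)" if S: "L S" and T: "L T" for S T
    unfolding L_def
  proof (intro conjI ballI)
    show "S \<inter> T \<subseteq> X" using S unfolding L_def by blast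
    fix x assume x: "x \<in> S \<inter> T"
    obtain F e where F: "finite F" "F \<subseteq> P" "e > 0" "N F e x \<subseteq> S"
      using S x unfolding L_def by blast
    obtain G d where G: "finite G" "G \<subseteq> P" "d > 0" "N G d x \<subseteq> T"
      using T x unfolding L_def by blast
    have "N (F \<union> G) (min e d) x \<subseteq> N F e x" "N (F \<union> G) (min e d) x \<subseteq> N G d x"
      by (auto simp: N_def)
    then have "N (F \<union> G) (min e d) x \<subseteq> S \<inter> T"
      using F(4) G(4) by blast
    moreover have "finite (F \<union> G)" "F \<union> G \<subseteq> P" "min e d > 0"
      using F G by auto
    ultimately show "\<exists>F e. finite F \<and> F \<subseteq> P \<and> e > 0 \<and> N F e x \<subseteq> S \<inter> T"
      by blast
  qed
  moreover have "L (\<Union>K)" if K: "\<forall>S\<in>K. L S" for K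
    unfolding L_def
  proof (intro conjI ballI)
    show "\<Union>K \<subseteq> X" using K unfolding L_def by blast
    fix x assume "x \<in> \<Union>K"
    then obtain S where S: "S \<in> K" "x \<in> S" by blast
    then have "L S" using K by blast
    then obtain F e where F: "finite F" "F \<subseteq> P" "e > 0" "N F e x \<subseteq> S"
      using S(2) unfolding L_def by blast
    have "N F e x \<subseteq> \<Union>K" using F(4) S(1) by blast
    with F show "\<exists>F e. finite F \<and> F \<subseteq> P \<and> e > 0 \<and> N F e x \<subseteq> \<Union>K"
      by blast
  qed
  ultimately have "istopology L"
    unfolding istopology_def by blast
  moreover have "seminorm_topology X P = topology L"
    unfolding seminorm_topology_def L_def N_def ..
  ultimately have "openin (seminorm_topology X P) U \<longleftrightarrow> L U"
    by (simp only: topology_inverse')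
  then show ?thesis
    unfolding L_def N_def .
qed

lemma topspace_seminorm_topology [simp]: "topspace (seminorm_topology X P) = X"
proof (rule subset_antisym)
  have "openin (seminorm_topology X P) (topspace (seminorm_topology X P))"
    by (rule openin_topspace)
  then show "topspace (seminorm_topology X P) \<subseteq> X"
    by (simp only: openin_seminorm_topology)
  have "openin (seminorm_topology X P) X"
    unfolding openin_seminorm_topology
    by (intro conjI ballI exI[of _ "{}"] exI[of _ "1::real"]) simp_all
  then show "X \<subseteq> topspace (seminorm_topology X P)"
    by (rule openin_subset)
qed

section \<open>Topological star-algebras\<close>

text \<open>The carrier is the topological space of the topology; addition is that of the type.\<close>

record 'a top_star_algebra =
  topo :: "'a topology"
  scale :: "complex \<Rightarrow> 'a \<Rightarrow> 'a"
  mult :: "'a \<Rightarrow> 'a \<Rightarrow> 'a"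
  star :: "'a \<Rightarrow> 'a"

definition closed_star_subalgebra :: "'a::ab_group_add top_star_algebra \<Rightarrow> 'a set \<Rightarrow> bool" where
  "closed_star_subalgebra M A \<longleftrightarrow>
     closedin (topo M) A \<and> A \<noteq> {} \<and>
     (\<forall>x\<in>A. \<forall>y\<in>A. x + y \<in> A) \<and>
     (\<forall>c. \<forall>x\<in>A. scale M c x \<in> A) \<and>
     (\<forall>x\<in>A. \<forall>y\<in>A. mult M x y \<in> A) \<and>
     (\<forall>x\<in>A. star M x \<in> A)"

definition restrict_algebra :: "'a top_star_algebra \<Rightarrow> 'a set \<Rightarrow> 'a top_star_algebra" where
  "restrict_algebra M A = M\<lparr>topo := subtopology (topo M) A\<rparr>"

definition commutative_algebra :: "'a top_star_algebra \<Rightarrow> bool" where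
  "commutative_algebra M \<longleftrightarrow>
     (\<forall>x\<in>topspace (topo M). \<forall>y\<in>topspace (topo M). mult M x y = mult M y x)"

definition top_star_isomorphism ::
  "'a::ab_group_add top_star_algebra \<Rightarrow> 'b::ab_group_add top_star_algebra \<Rightarrow> ('a \<Rightarrow> 'b) \<Rightarrow> bool" where
  "top_star_isomorphism M N f \<longleftrightarrow>
     homeomorphic_map (topo M) (topo N) f \<and>
     (\<forall>x\<in>topspace (topo M). \<forall>y\<in>topspace (topo M). f (x + y) = f x + f y) \<and>
     (\<forall>c. \<forall>x\<in>topspace (topo M). f (scale M c x) = scale N c (f x)) \<and>
     (\<forall>x\<in>topspace (topo M). \<forall>y\<in>topspace (topo M). f (mult M x y) = mult N (f x) (f y)) \<and>
     (\<forall>x\<in>topspace (topo M). f (star M x) = star N (f x))"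

definition top_star_isomorphic ::
  "'a::ab_group_add top_star_algebra \<Rightarrow> 'b::ab_group_add top_star_algebra \<Rightarrow> bool" where
  "top_star_isomorphic M N \<longleftrightarrow> (\<exists>f. top_star_isomorphism M N f)"

section \<open>The algebra of rapidly decreasing sequences and its dual\<close>

text \<open>Sequences are indexed from 0, so the weight at index \<open>j\<close> is a power of \<open>Suc j\<close>.\<close>

type_synonym cseq = "nat \<Rightarrow> complex"

definition seq_scale :: "complex \<Rightarrow> cseq \<Rightarrow> cseq" where
  "seq_scale c \<xi> = (\<lambda>j. c * \<xi> j)"

definition s_space :: "cseq set" where
  "s_space = {\<xi>. \<forall>q::nat. summable (\<lambda>j. (cmod (\<xi> j))\<^sup>2 * real (Suc j) ^ (2 * q))}"

definition s_norm :: "nat \<Rightarrow> cseq \<Rightarrow> real" where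
  "s_norm q \<xi> = sqrt (\<Sum>j. (cmod (\<xi> j))\<^sup>2 * real (Suc j) ^ (2 * q))"

definition s_topology :: "cseq topology" where
  "s_topology = seminorm_topology s_space (range s_norm)"

definition s_algebra :: "cseq top_star_algebra" where
  "s_algebra = \<lparr>topo = s_topology, scale = seq_scale, mult = (*), star = (\<lambda>\<xi> j. cnj (\<xi> j))\<rparr>"

definition dual_step :: "nat \<Rightarrow> cseq set" where
  "dual_step q = {\<xi>. summable (\<lambda>j. (cmod (\<xi> j))\<^sup>2 / real (Suc j) ^ (2 * q))}"

definition dual_norm :: "nat \<Rightarrow> cseq \<Rightarrow> real" where
  "dual_norm q \<xi> = sqrt (\<Sum>j. (cmod (\<xi> j))\<^sup>2 / real (Suc j) ^ (2 * q))"

definition s_dual :: "cseq set" where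
  "s_dual = (\<Union>q. dual_step q)"

text \<open>The locally convex inductive limit topology of the steps is the finest locally convex
  topology making all inclusions of steps continuous, so it is given by all seminorms whose
  restriction to each step is continuous.\<close>

definition s_dual_seminorms :: "(cseq \<Rightarrow> real) set" where
  "s_dual_seminorms = {p.
     (\<forall>\<xi>\<in>s_dual. \<forall>\<eta>\<in>s_dual. p (\<xi> + \<eta>) \<le> p \<xi> + p \<eta>) \<and>
     (\<forall>c. \<forall>\<xi>\<in>s_dual. p (seq_scale c \<xi>) = cmod c * p \<xi>) \<and>
     (\<forall>q. \<exists>C. \<forall>\<xi>\<in>dual_step q. p \<xi> \<le> C * dual_norm q \<xi>)}"

definition s_dual_topology :: "cseq topology" where
  "s_dual_topology = seminorm_topology s_dual s_dual_seminorms"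

section \<open>The algebra of smooth operators\<close>

text \<open>An operator on \<^const>\<open>s_dual\<close> is represented by its extension by 0 to all sequences,
  so that equality of representatives is equality of operators and the pointwise operations and
  composition of representatives are those of the operators.\<close>

definition smooth_ops :: "(cseq \<Rightarrow> cseq) set" where
  "smooth_ops = {x.
     continuous_map s_dual_topology s_topology x \<and>
     (\<forall>\<xi>\<in>s_dual. \<forall>\<eta>\<in>s_dual. x (\<xi> + \<eta>) = x \<xi> + x \<eta>) \<and>
     (\<forall>c. \<forall>\<xi>\<in>s_dual. x (seq_scale c \<xi>) = seq_scale c (x \<xi>)) \<and>
     (\<forall>\<xi>. \<xi> \<notin> s_dual \<longrightarrow> x \<xi> = 0)}"

text \<open>The supremum is over a set of reals that is bounded above for every \<^const>\<open>smooth_ops\<close>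
  element: then \<open>s_norm q \<circ> x\<close> is a continuous seminorm on \<^const>\<open>s_dual\<close>.\<close>

definition op_norm :: "nat \<Rightarrow> (cseq \<Rightarrow> cseq) \<Rightarrow> real" where
  "op_norm q x = (SUP \<xi>\<in>{\<xi> \<in> dual_step q. dual_norm q \<xi> \<le> 1}. s_norm q (x \<xi>))"

definition ell2 :: "cseq set" where
  "ell2 = {\<xi>. summable (\<lambda>j. (cmod (\<xi> j))\<^sup>2)}"

definition ell2_inner :: "cseq \<Rightarrow> cseq \<Rightarrow> complex" where
  "ell2_inner \<xi> \<eta> = (\<Sum>j. \<xi> j * cnj (\<eta> j))"

text \<open>The Hilbert space adjoint of the induced operator on \<^const>\<open>ell2\<close>; it is again induced by
  an element of \<^const>\<open>smooth_ops\<close>, which is unique because \<^const>\<open>ell2\<close> is dense in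
  \<^const>\<open>s_dual\<close>.\<close>

definition op_adjoint :: "(cseq \<Rightarrow> cseq) \<Rightarrow> (cseq \<Rightarrow> cseq)" where
  "op_adjoint x = (THE y. y \<in> smooth_ops \<and>
     (\<forall>\<xi>\<in>ell2. \<forall>\<eta>\<in>ell2. ell2_inner (x \<xi>) \<eta> = ell2_inner \<xi> (y \<eta>)))"

definition smooth_op_algebra :: "(cseq \<Rightarrow> cseq) top_star_algebra" where
  "smooth_op_algebra =
     \<lparr>topo = seminorm_topology smooth_ops (range op_norm),
      scale = (\<lambda>c x \<xi>. seq_scale c (x \<xi>)),
      mult = (\<circ>),
      star = op_adjoint\<rparr>"

end

theory Submission imports Defs "HOL-Real_Asymp.Real_Asymp" begin

text \<open>
  The norms of an idempotent of \<^const>\<open>s_space\<close> are tied together: such a sequence is the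
  indicator of a finite set \<open>J\<close> of indices, and a sum of powers of positive numbers is at most the
  power of their sum, so \<open>|e|\<^sub>r \<le> |e|\<^sub>1\<^sup>r\<close> for all \<open>r \<ge> 1\<close> (\<open>s_idempotent_norm\<close>). If a closed
  star-subalgebra \<open>A\<close> of the smooth operators were isomorphic to a closed star-subalgebra of
  \<open>s\<close>, this property would be transported to \<open>A\<close>: continuity of the isomorphism
  bounds \<open>|\<phi>(x)|\<^sub>1\<close> by a multiple of some \<open>\<parallel>x\<parallel>\<^sub>p\<close>, and continuity of its inverse bounds
  \<open>\<parallel>x\<parallel>\<^sub>p\<^sub>+\<^sub>1\<close> by a multiple of some \<open>|\<phi>(x)|\<^sub>r\<close>, where \<open>r \<ge> 1\<close> without loss of generality. So there
  would be one \<open>p\<close> such that \<open>\<parallel>P\<parallel>\<^sub>p\<^sub>+\<^sub>1\<close> is bounded by a fixed power of \<open>\<parallel>P\<parallel>\<^sub>p\<close>, up to constants,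
  for all projections \<open>P\<close> in \<open>A\<close>.

  It is easy to violate this for projections of rank one, because a unit vector, in contrast to an
  indicator, may have a very small entry at a very large index. Let
  \<open>f = e\<^sub>a + B\<^sup>-\<^sup>p e\<^sub>b\<close>, where the basis vectors \<open>e\<^sub>a\<close> and \<open>e\<^sub>b\<close> have weights \<open>a\<close> and \<open>B\<close>, and let
  \<open>P\<close> be the orthogonal projection onto the line through \<open>f\<close>. The norms of \<open>P\<close> are those
  of \<open>f\<close>, squared, up to a factor between 1 and 2. The factor \<open>B\<^sup>-\<^sup>p\<close> just hides \<open>B\<close> from the
  norm of index \<open>p\<close>, which is of order \<open>a\<^sup>2\<^sup>p\<close>, whereas the norm of index \<open>p + 1\<close> is at least of
  order \<open>B\<^sup>2\<close>. With \<open>B\<close> exponentially large in \<open>a\<close> no power of the former controls the latter.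
  Disjoint supports allow this for every \<open>p\<close> and arbitrarily large \<open>a\<close> within a single
  orthogonal family (\<open>test_projection_not_tame\<close>).

  It remains to put the family \<open>S\<close> of these projections into a closed commutative
  star-subalgebra. Its bicommutant within the smooth operators is one by the usual formal argument,
  since \<open>S\<close> consists of commuting self-adjoint elements. The analytic inputs are that
  multiplication is separately continuous and that the adjoint, which is defined by a
  description, exists, is an involution and reverses products.
\<close>

section \<open>Weighted square-summable sequences\<close>

text \<open>The norms of \<open>s\<close> and those of the steps of its dual are weighted square norms whose weights
  are reciprocal to each other, so both are treated at once.\<close>

definition wspace :: "(nat \<Rightarrow> real) \<Rightarrow> cseq set" where
  "wspace u = {\<xi>. summable (\<lambda>j. (cmod (\<xi> j) * u j)\<^sup>2)}"

definition wnorm :: "(nat \<Rightarrow> real) \<Rightarrow> cseq \<Rightarrow> real" where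
  "wnorm u \<xi> = sqrt (\<Sum>j. (cmod (\<xi> j) * u j)\<^sup>2)"

lemma wnorm_nonneg: "\<xi> \<in> wspace u \<Longrightarrow> 0 \<le> wnorm u \<xi>"
  unfolding wnorm_def wspace_def by (simp add: suminf_nonneg)

lemma partial_le_wnorm:
  assumes "\<xi> \<in> wspace u" "finite F"
  shows "L2_set (\<lambda>j. cmod (\<xi> j) * u j) F \<le> wnorm u \<xi>"
  using assms unfolding L2_set_def wnorm_def wspace_def
  by (intro real_sqrt_le_mono sum_le_suminf) auto

lemma wnorm_leI:
  assumes M: "0 \<le> M" and le: "\<And>n. L2_set (\<lambda>j. cmod (\<xi> j) * u j) {..<n} \<le> M"
  shows "\<xi> \<in> wspace u" "wnorm u \<xi> \<le> M"
proof -
  have s: "(\<Sum>j<n. (cmod (\<xi> j) * u j)\<^sup>2) \<le> M\<^sup>2" for n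
    using le[of n] unfolding L2_set_def by (rule sqrt_le_D)
  have sm: "summable (\<lambda>j. (cmod (\<xi> j) * u j)\<^sup>2)"
    using s by (intro summableI_nonneg_bounded[where x="M\<^sup>2"]) auto
  show "\<xi> \<in> wspace u" using sm by (simp add: wspace_def)
  have "(\<Sum>j. (cmod (\<xi> j) * u j)\<^sup>2) \<le> M\<^sup>2"
    by (rule suminf_le_const[OF sm s])
  then show "wnorm u \<xi> \<le> M" unfolding wnorm_def
    using M real_le_lsqrt by blast
qed

lemma wnorm_add:
  assumes x: "\<xi> \<in> wspace u" and y: "\<eta> \<in> wspace u" and u: "\<And>j. 0 \<le> u j"
  shows "\<xi> + \<eta> \<in> wspace u" "wnorm u (\<xi> + \<eta>) \<le> wnorm u \<xi> + wnorm u \<eta>"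
proof -
  have "L2_set (\<lambda>j. cmod ((\<xi> + \<eta>) j) * u j) {..<n} \<le> wnorm u \<xi> + wnorm u \<eta>" for n
  proof -
    have "L2_set (\<lambda>j. cmod ((\<xi> + \<eta>) j) * u j) {..<n}
        \<le> L2_set (\<lambda>j. cmod (\<xi> j) * u j + cmod (\<eta> j) * u j) {..<n}"
      using u by (intro L2_set_mono) (auto simp: distrib_right[symmetric] norm_triangle_ineq mult_right_mono)
    also have "\<dots> \<le> L2_set (\<lambda>j. cmod (\<xi> j) * u j) {..<n} + L2_set (\<lambda>j. cmod (\<eta> j) * u j) {..<n}"
      by (rule L2_set_triangle_ineq)
    also have "\<dots> \<le> wnorm u \<xi> + wnorm u \<eta>"
      using x y by (intro add_mono partial_le_wnorm) auto
    finally show ?thesis .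
  qed
  moreover have "0 \<le> wnorm u \<xi> + wnorm u \<eta>"
    using x y wnorm_nonneg by (simp add: add_nonneg_nonneg)
  ultimately show "\<xi> + \<eta> \<in> wspace u" "wnorm u (\<xi> + \<eta>) \<le> wnorm u \<xi> + wnorm u \<eta>"
    using wnorm_leI by blast+
qed

lemma wnorm_scale:
  assumes x: "\<xi> \<in> wspace u"
  shows "seq_scale c \<xi> \<in> wspace u" "wnorm u (seq_scale c \<xi>) = cmod c * wnorm u \<xi>"
proof -
  have eq: "(cmod (seq_scale c \<xi> j) * u j)\<^sup>2 = (cmod c)\<^sup>2 * (cmod (\<xi> j) * u j)\<^sup>2" for j
    by (simp add: seq_scale_def norm_mult power_mult_distrib)
  show "seq_scale c \<xi> \<in> wspace u" using x
    unfolding wspace_def mem_Collect_eq eq by (rule summable_mult)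
  show "wnorm u (seq_scale c \<xi>) = cmod c * wnorm u \<xi>"
    using x unfolding wnorm_def eq wspace_def
    by (simp add: suminf_mult real_sqrt_mult)
qed

lemma coord_le_wnorm:
  assumes "\<xi> \<in> wspace u" "0 \<le> u j"
  shows "cmod (\<xi> j) * u j \<le> wnorm u \<xi>"
  using partial_le_wnorm[OF assms(1), of "{j}"] assms(2) by (simp add: L2_set_def)

lemma wnorm_mono:
  assumes x: "\<xi> \<in> wspace v" and u: "\<And>j. 0 \<le> u j" "\<And>j. u j \<le> v j"
  shows "\<xi> \<in> wspace u" "wnorm u \<xi> \<le> wnorm v \<xi>"
proof -
  have "L2_set (\<lambda>j. cmod (\<xi> j) * u j) {..<n} \<le> wnorm v \<xi>" for n
  proof -
    have "L2_set (\<lambda>j. cmod (\<xi> j) * u j) {..<n} \<le> L2_set (\<lambda>j. cmod (\<xi> j) * v j) {..<n}"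
      using u by (intro L2_set_mono) (auto intro: mult_left_mono)
    also have "\<dots> \<le> wnorm v \<xi>" using x by (intro partial_le_wnorm) auto
    finally show ?thesis .
  qed
  with wnorm_nonneg[OF x] show "\<xi> \<in> wspace u" "wnorm u \<xi> \<le> wnorm v \<xi>"
    using wnorm_leI by blast+
qed

text \<open>Cauchy-Schwarz, with the weights cancelling in the product.\<close>

lemma pairing_bound:
  assumes x: "\<xi> \<in> wspace u" and y: "\<eta> \<in> wspace v" and uv: "\<And>j. u j * v j = 1"
    "\<And>j. 0 \<le> u j" "\<And>j. 0 \<le> v j"
  shows "summable (\<lambda>j. \<xi> j * cnj (\<eta> j))" "cmod (ell2_inner \<xi> \<eta>) \<le> wnorm u \<xi> * wnorm v \<eta>"
proof -
  have part: "(\<Sum>j<n. cmod (\<xi> j * cnj (\<eta> j))) \<le> wnorm u \<xi> * wnorm v \<eta>" for n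
  proof -
    have "(\<Sum>j<n. cmod (\<xi> j * cnj (\<eta> j))) = (\<Sum>j<n. \<bar>cmod (\<xi> j) * u j\<bar> * \<bar>cmod (\<eta> j) * v j\<bar>)"
    proof (rule sum.cong[OF refl])
      fix j
      have "\<bar>cmod (\<xi> j) * u j\<bar> * \<bar>cmod (\<eta> j) * v j\<bar> = cmod (\<xi> j) * cmod (\<eta> j) * (u j * v j)"
        using uv(2,3)[of j] by (simp add: abs_mult)
      then show "cmod (\<xi> j * cnj (\<eta> j)) = \<bar>cmod (\<xi> j) * u j\<bar> * \<bar>cmod (\<eta> j) * v j\<bar>"
        by (simp add: uv(1) norm_mult)
    qed
    also have "\<dots> \<le> L2_set (\<lambda>j. cmod (\<xi> j) * u j) {..<n} * L2_set (\<lambda>j. cmod (\<eta> j) * v j) {..<n}"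
      by (rule L2_set_mult_ineq)
    also have "\<dots> \<le> wnorm u \<xi> * wnorm v \<eta>"
      using x y by (intro mult_mono partial_le_wnorm wnorm_nonneg) (auto simp: L2_set_nonneg)
    finally show ?thesis .
  qed
  have sm: "summable (\<lambda>j. cmod (\<xi> j * cnj (\<eta> j)))"
    using part by (intro summableI_nonneg_bounded) auto
  show "summable (\<lambda>j. \<xi> j * cnj (\<eta> j))" using sm by (rule summable_norm_cancel)
  have "cmod (ell2_inner \<xi> \<eta>) \<le> (\<Sum>j. cmod (\<xi> j * cnj (\<eta> j)))"
    unfolding ell2_inner_def by (rule summable_norm[OF sm])
  also have "\<dots> \<le> wnorm u \<xi> * wnorm v \<eta>" by (rule suminf_le_const[OF sm part])
  finally show "cmod (ell2_inner \<xi> \<eta>) \<le> wnorm u \<xi> * wnorm v \<eta>" .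
qed

definition trunc :: "nat \<Rightarrow> cseq \<Rightarrow> cseq" where
  "trunc n \<xi> = (\<lambda>j. if j < n then \<xi> j else 0)"

lemma trunc_tendsto:
  assumes x: "\<xi> \<in> wspace u"
  shows "\<xi> - trunc n \<xi> \<in> wspace u" "(\<lambda>n. wnorm u (\<xi> - trunc n \<xi>)) \<longlonglongrightarrow> 0"
proof -
  define a where "a j = (cmod (\<xi> j) * u j)\<^sup>2" for j
  have sa: "summable a" using x by (simp add: wspace_def a_def[abs_def])
  have eq: "(\<lambda>j. (cmod ((\<xi> - trunc n \<xi>) j) * u j)\<^sup>2) = (\<lambda>j. if j < n then 0 else a j)" for n
    by (auto simp: trunc_def a_def)
  have sm: "(\<lambda>j. if j < n then 0 else a j) sums (suminf a - (\<Sum>j<n. a j))" for n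
  proof -
    have "(\<lambda>j. a j - (if j \<in> {..<n} then a j else 0)) sums (suminf a - (\<Sum>j<n. a j))"
      by (intro sums_diff summable_sums sa sums_If_finite_set) simp
    moreover have "(\<lambda>j. a j - (if j \<in> {..<n} then a j else 0)) = (\<lambda>j. if j < n then 0 else a j)"
      by auto
    ultimately show ?thesis by simp
  qed
  show "\<xi> - trunc n \<xi> \<in> wspace u"
    unfolding wspace_def using sm[of n] eq[of n] by (auto simp: sums_iff)
  have "wnorm u (\<xi> - trunc n \<xi>) = sqrt (suminf a - (\<Sum>j<n. a j))" for n
    unfolding wnorm_def eq using sm[of n] by (simp add: sums_iff)
  moreover have "(\<lambda>n. sqrt (suminf a - (\<Sum>j<n. a j))) \<longlonglongrightarrow> sqrt (suminf a - suminf a)"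
    by (intro tendsto_intros summable_LIMSEQ sa)
  ultimately show "(\<lambda>n. wnorm u (\<xi> - trunc n \<xi>)) \<longlonglongrightarrow> 0" by simp
qed

section \<open>The norms of s and of its dual\<close>

lemma s_space_eq: "s_space = (\<Inter>q. wspace (\<lambda>j. real (Suc j) ^ q))"
  unfolding s_space_def wspace_def power_mult_distrib power_mult[symmetric]
  by (auto simp: mult.commute)

lemma s_norm_eq: "s_norm q = wnorm (\<lambda>j. real (Suc j) ^ q)"
  unfolding s_norm_def wnorm_def power_mult_distrib power_mult[symmetric]
  by (auto simp: mult.commute)

lemma dual_step_eq: "dual_step q = wspace (\<lambda>j. 1 / real (Suc j) ^ q)"
  unfolding dual_step_def wspace_def power_mult_distrib power_mult[symmetric] power_divide
  by (simp add: mult.commute)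

lemma dual_norm_eq: "dual_norm q = wnorm (\<lambda>j. 1 / real (Suc j) ^ q)"
  unfolding dual_norm_def wnorm_def power_mult_distrib power_mult[symmetric] power_divide
  by (auto simp: mult.commute)

lemma s_spaceD: "\<xi> \<in> s_space \<Longrightarrow> \<xi> \<in> wspace (\<lambda>j. real (Suc j) ^ q)"
  by (auto simp: s_space_eq)

lemma s_norm_nonneg: "\<xi> \<in> s_space \<Longrightarrow> 0 \<le> s_norm q \<xi>"
  unfolding s_norm_eq by (rule wnorm_nonneg[OF s_spaceD])

lemma s_add:
  assumes "\<xi> \<in> s_space" "\<eta> \<in> s_space"
  shows "\<xi> + \<eta> \<in> s_space" "s_norm q (\<xi> + \<eta>) \<le> s_norm q \<xi> + s_norm q \<eta>"
  using wnorm_add[OF assms[THEN s_spaceD]] unfolding s_norm_eq by (auto simp: s_space_eq)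

lemma s_scale:
  assumes "\<xi> \<in> s_space"
  shows "seq_scale c \<xi> \<in> s_space" "s_norm q (seq_scale c \<xi>) = cmod c * s_norm q \<xi>"
  using wnorm_scale[OF assms[THEN s_spaceD]] unfolding s_norm_eq by (auto simp: s_space_eq)

lemma s_coord_le:
  assumes "\<xi> \<in> s_space" shows "cmod (\<xi> j) * real (Suc j) ^ q \<le> s_norm q \<xi>"
  unfolding s_norm_eq by (rule coord_le_wnorm[OF s_spaceD[OF assms]]) simp

lemma s_norm_eq_0:
  assumes "\<xi> \<in> s_space" "s_norm q \<xi> \<le> 0" shows "\<xi> = 0"
proof
  fix j
  have "cmod (\<xi> j) * real (Suc j) ^ q \<le> 0" using s_coord_le[OF assms(1)] assms(2) by (rule order_trans)
  moreover have "0 < real (Suc j) ^ q" by simp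
  ultimately have "cmod (\<xi> j) \<le> 0" by (metis mult_le_0_iff not_le)
  then show "\<xi> j = 0 j" by simp
qed

lemma s_norm_mono: "\<xi> \<in> s_space \<Longrightarrow> q \<le> r \<Longrightarrow> s_norm q \<xi> \<le> s_norm r \<xi>"
  unfolding s_norm_eq by (rule wnorm_mono[OF s_spaceD]) (auto intro: power_increasing)

lemma s_zero: "0 \<in> s_space"
  by (simp add: s_space_def)

lemma diff_eq_scale: "\<xi> - \<eta> = \<xi> + seq_scale (-1) \<eta>"
  by (auto simp: seq_scale_def)

lemma s_diff: "\<xi> \<in> s_space \<Longrightarrow> \<eta> \<in> s_space \<Longrightarrow> \<xi> - \<eta> \<in> s_space"
  unfolding diff_eq_scale by (intro s_add s_scale)

lemma dual_step_mono: 
  assumes "\<xi> \<in> dual_step q" "q \<le> r" 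
  shows "\<xi> \<in> dual_step r" "dual_norm r \<xi> \<le> dual_norm q \<xi>"
  using assms(1) unfolding dual_norm_eq dual_step_eq 
  by (rule wnorm_mono, simp, simp add: assms(2) frac_le power_increasing)+

lemma s_dual_step:
  assumes "\<xi> \<in> s_space" shows "\<xi> \<in> dual_step q" "dual_norm q \<xi> \<le> s_norm 0 \<xi>"
  unfolding dual_norm_eq dual_step_eq s_norm_eq
  by (rule wnorm_mono[OF s_spaceD[OF assms, of 0]], simp, simp del: of_nat_Suc add: field_simps)+

lemma dual_norm_nonneg: "\<xi> \<in> dual_step q \<Longrightarrow> 0 \<le> dual_norm q \<xi>"
  unfolding dual_norm_eq dual_step_eq by (rule wnorm_nonneg)

lemma dual_add:
  assumes "\<xi> \<in> dual_step q" "\<eta> \<in> dual_step q"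
  shows "\<xi> + \<eta> \<in> dual_step q" "dual_norm q (\<xi> + \<eta>) \<le> dual_norm q \<xi> + dual_norm q \<eta>"
  using wnorm_add assms unfolding dual_norm_eq dual_step_eq by auto

lemma dual_scale:
  assumes "\<xi> \<in> dual_step q"
  shows "seq_scale c \<xi> \<in> dual_step q" "dual_norm q (seq_scale c \<xi>) = cmod c * dual_norm q \<xi>"
  using wnorm_scale assms unfolding dual_norm_eq dual_step_eq by auto

lemma s_subset_dual: "\<xi> \<in> s_space \<Longrightarrow> \<xi> \<in> s_dual"
  unfolding s_dual_def using s_dual_step by blast

lemma dual_step_subset: "\<xi> \<in> dual_step q \<Longrightarrow> \<xi> \<in> s_dual"
  unfolding s_dual_def by blast

lemma s_dual_common_step:
  assumes "\<xi> \<in> s_dual" "\<eta> \<in> s_dual"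
  obtains q where "\<xi> \<in> dual_step q" "\<eta> \<in> dual_step q"
proof -
  obtain q r where "\<xi> \<in> dual_step q" "\<eta> \<in> dual_step r" using assms by (auto simp: s_dual_def)
  then show ?thesis using dual_step_mono(1) that[of "max q r"] by (meson max.cobounded1 max.cobounded2)
qed

lemma s_dual_add: "\<xi> \<in> s_dual \<Longrightarrow> \<eta> \<in> s_dual \<Longrightarrow> \<xi> + \<eta> \<in> s_dual"
  by (metis s_dual_common_step dual_add(1) dual_step_subset)

lemma s_dual_scale: "\<xi> \<in> s_dual \<Longrightarrow> seq_scale c \<xi> \<in> s_dual"
  unfolding s_dual_def using dual_scale by blast

lemma s_dual_zero: "0 \<in> s_dual"
  by (rule s_subset_dual[OF s_zero])

lemma s_dual_pairing:
  assumes "\<xi> \<in> s_space" "\<eta> \<in> dual_step q"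
  shows "summable (\<lambda>j. \<xi> j * cnj (\<eta> j))" "cmod (ell2_inner \<xi> \<eta>) \<le> s_norm q \<xi> * dual_norm q \<eta>"
  using pairing_bound[OF s_spaceD[OF assms(1), of q], of \<eta> "\<lambda>j. 1 / real (Suc j) ^ q"] assms(2)
  unfolding dual_norm_eq dual_step_eq s_norm_eq by auto

lemma dual_s_pairing_summable:
  assumes "\<xi> \<in> s_dual" "\<eta> \<in> s_space"
  shows "summable (\<lambda>j. \<xi> j * cnj (\<eta> j))"
proof -
  obtain q where q: "\<xi> \<in> dual_step q" using assms(1) by (auto simp: s_dual_def)
  have "summable (\<lambda>j. cnj (\<eta> j * cnj (\<xi> j)))"
    using summable_sums[OF s_dual_pairing(1)[OF assms(2) q], THEN sums_cnj[THEN iffD2]]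
    by (rule sums_summable)
  then show ?thesis by (simp add: mult.commute)
qed

lemma ell2_inner_cnj:
  assumes "\<xi> \<in> s_dual" "\<eta> \<in> s_space"
  shows "ell2_inner \<eta> \<xi> = cnj (ell2_inner \<xi> \<eta>)"
proof -
  have "(\<lambda>j. cnj (\<xi> j * cnj (\<eta> j))) sums cnj (ell2_inner \<xi> \<eta>)"
    unfolding ell2_inner_def sums_cnj
    using dual_s_pairing_summable[OF assms] by (rule summable_sums)
  then show ?thesis unfolding ell2_inner_def by (simp add: sums_iff mult.commute)
qed

lemma dual_s_pairing_bound:
  assumes "\<xi> \<in> dual_step q" "\<eta> \<in> s_space"
  shows "cmod (ell2_inner \<xi> \<eta>) \<le> dual_norm q \<xi> * s_norm q \<eta>"
  using s_dual_pairing(2)[OF assms(2,1)] ell2_inner_cnj[OF dual_step_subset[OF assms(1)] assms(2)]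
  by (simp add: mult.commute)

lemma ell2_inner_add_left:
  assumes "\<xi> \<in> s_dual" "\<xi>' \<in> s_dual" "\<eta> \<in> s_space"
  shows "ell2_inner (\<xi> + \<xi>') \<eta> = ell2_inner \<xi> \<eta> + ell2_inner \<xi>' \<eta>"
  unfolding ell2_inner_def
  using suminf_add[OF dual_s_pairing_summable[OF assms(1,3)] dual_s_pairing_summable[OF assms(2,3)]]
  by (simp add: distrib_right)

lemma ell2_inner_scale_left: "ell2_inner (seq_scale c \<xi>) \<eta> = c * ell2_inner \<xi> \<eta>"
  if "\<xi> \<in> s_dual" "\<eta> \<in> s_space"
  unfolding ell2_inner_def seq_scale_def
  using suminf_mult[OF dual_s_pairing_summable[OF that], of c] by (simp add: mult.assoc)

definition unit_seq :: "nat \<Rightarrow> cseq" where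
  "unit_seq j = (\<lambda>i. if i = j then 1 else 0)"

lemma unit_seq_s: "unit_seq j \<in> s_space"
  unfolding s_space_def mem_Collect_eq
  by (intro allI summable_finite[of "{j}"]) (auto simp: unit_seq_def)

lemma dual_norm_unit_seq: "dual_norm q (unit_seq j) = 1 / real (Suc j) ^ q"
proof -
  have "(\<Sum>i. (cmod (unit_seq j i) * (1 / real (Suc i) ^ q))\<^sup>2) = (\<Sum>i\<in>{j}. (cmod (unit_seq j i) * (1 / real (Suc i) ^ q))\<^sup>2)"
    by (rule suminf_finite) (auto simp: unit_seq_def)
  then show ?thesis unfolding dual_norm_eq wnorm_def by (simp add: unit_seq_def power_divide real_sqrt_divide)
qed

lemma ell2_inner_unit_left: "ell2_inner (unit_seq j) \<eta> = cnj (\<eta> j)"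
proof -
  have "(\<Sum>i. unit_seq j i * cnj (\<eta> i)) = (\<Sum>i\<in>{j}. unit_seq j i * cnj (\<eta> i))"
    by (rule suminf_finite) (auto simp: unit_seq_def)
  then show ?thesis by (simp add: ell2_inner_def unit_seq_def)
qed

lemma trunc_s: "trunc n \<xi> \<in> s_space"
  unfolding s_space_def mem_Collect_eq
  by (intro allI summable_finite[of "{..<n}"]) (auto simp: trunc_def)

lemma trunc_Suc: "trunc (Suc n) \<xi> = trunc n \<xi> + seq_scale (\<xi> n) (unit_seq n)"
  by (auto simp: trunc_def seq_scale_def unit_seq_def less_Suc_eq)

lemma ell2_eq_dual_step: "ell2 = dual_step 0"
  by (simp add: ell2_def dual_step_def)

lemma ell2_dual: "\<xi> \<in> ell2 \<Longrightarrow> \<xi> \<in> s_dual"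
  unfolding ell2_eq_dual_step by (rule dual_step_subset)

lemma s_ell2: "\<xi> \<in> s_space \<Longrightarrow> \<xi> \<in> ell2"
  unfolding ell2_eq_dual_step by (rule s_dual_step)


section \<open>Continuity as boundedness\<close>

lemma openin_seminorm_ball:
  assumes q: "q \<in> Q" and tri: "\<And>x y. x \<in> Y \<Longrightarrow> y \<in> Y \<Longrightarrow> q y \<le> q x + q (y - x)"
  shows "openin (seminorm_topology Y Q) {y \<in> Y. q y < 1}"
  unfolding openin_seminorm_topology
proof (intro conjI ballI)
  fix x assume x: "x \<in> {y \<in> Y. q y < 1}"
  have "{y \<in> Y. \<forall>p\<in>{q}. p (y - x) < 1 - q x} \<subseteq> {y \<in> Y. q y < 1}"
    using x tri[of x] by fastforce
  then show "\<exists>F e. finite F \<and> F \<subseteq> Q \<and> e > 0 \<and> {y \<in> Y. \<forall>p\<in>F. p (y - x) < e} \<subseteq> {y \<in> Y. q y < 1}"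
    using q x by (intro exI[of _ "{q}"] exI[of _ "1 - q x"]) auto
qed auto

text \<open>The usual argument that continuity at 0 gives boundedness: the preimage of the unit ball of \<open>q\<close>
  contains a basic neighbourhood of 0, and by homogeneity every point can be scaled into it. The estimate is by a sum over \<open>F\<close>
  instead of a maximum so that \<open>F = {}\<close> is no special case. The scalar multiplications are
  parameters because the two spaces of sequences and of operators have different ones.\<close>

lemma continuous_homogeneous_bound:
  fixes f :: "'a::ab_group_add \<Rightarrow> 'b::ab_group_add"
  assumes cont: "continuous_map (subtopology (seminorm_topology X P) A) (subtopology (seminorm_topology Y Q) B) f"
    and A: "0 \<in> A" "A \<subseteq> X" "\<And>c x. x \<in> A \<Longrightarrow> sc c x \<in> A"
    and hom: "\<And>c x. x \<in> A \<Longrightarrow> f (sc c x) = sc' c (f x)" and f0: "f 0 = 0"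
    and seminorms: "\<forall>p\<in>P. \<forall>x\<in>A. 0 \<le> p x \<and> (\<forall>c. p (sc c x) = cmod c * p x)"
    and q: "q \<in> Q" and q0: "q 0 = 0"
    and tri: "\<And>x y. x \<in> Y \<Longrightarrow> y \<in> Y \<Longrightarrow> q y \<le> q x + q (y - x)"
    and qsc: "\<And>c y. y \<in> Y \<Longrightarrow> q (sc' c y) = cmod c * q y"
  obtains F C where "finite F" "F \<subseteq> P" "0 < C" "\<And>x. x \<in> A \<Longrightarrow> q (f x) \<le> C * (\<Sum>p\<in>F. p x)"
proof -
  have P: "0 \<le> p x" "p (sc c x) = cmod c * p x" if "p \<in> P" "x \<in> A" for p x c
    using seminorms that by auto
  have fA: "f x \<in> Y" "f x \<in> B" if "x \<in> A" for x
    using continuous_map_image_subset_topspace[OF cont] that A(2) by auto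
  define V where "V = {y \<in> Y. q y < 1}"
  have "openin (subtopology (seminorm_topology Y Q) B) (V \<inter> B)"
    unfolding V_def using openin_seminorm_ball[of q Q Y] q tri by (auto simp: openin_subtopology)
  from openin_continuous_map_preimage[OF cont this]
  obtain U where U: "openin (seminorm_topology X P) U"
    and eq: "{x \<in> topspace (subtopology (seminorm_topology X P) A). f x \<in> V \<inter> B} = U \<inter> A"
    by (auto simp: openin_subtopology)
  have "0 \<in> U" using eq A fA[OF A(1)] f0 q0 by (auto simp: V_def)
  then obtain F e where F: "finite F" "F \<subseteq> P" "e > 0" "{y \<in> X. \<forall>p\<in>F. p (y - 0) < e} \<subseteq> U"
    using U unfolding openin_seminorm_topology by blast
  have small: "q (f x) < 1" if "x \<in> A" "\<And>p. p \<in> F \<Longrightarrow> p x < e" for x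
  proof -
    have "x \<in> U \<inter> A" using F(4) that A(2) by auto
    then show ?thesis unfolding eq[symmetric] by (simp add: V_def)
  qed
  have main: "q (f x) \<le> (1/e) * t" if x: "x \<in> A" and t: "t > (\<Sum>p\<in>F. p x)" for x t
  proof -
    have nn: "0 \<le> (\<Sum>p\<in>F. p x)" using P(1) F(2) x by (intro sum_nonneg) auto
    then have t0: "t > 0" using t by linarith
    \<comment> \<open>Scaling by \<open>t\<close> instead of the sum itself avoids dividing by 0.\<close>
    define c where "c = complex_of_real (e / t)"
    have cc: "cmod c = e / t" using t0 F(3) unfolding c_def norm_of_real by simp
    have "p (sc c x) < e" if p: "p \<in> F" for p
    proof -
      have "p x \<le> (\<Sum>p\<in>F. p x)" 
        using P(1) F x p by (intro member_le_sum) auto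
      then have "p x < t" using t by linarith
      then have "e / t * p x < e" using t0 F(3) by (simp add: field_simps)
      then show ?thesis using P(2)[of p x c] F(2) p x cc by auto
    qed
    then have "q (f (sc c x)) < 1" using small A(3) x by blast
    then have "e / t * q (f x) < 1" using hom[OF x] qsc fA(1)[OF x] cc by simp
    then show ?thesis using t0 F(3) by (simp add: field_simps)
  qed
  have "q (f x) \<le> (1/e) * (\<Sum>p\<in>F. p x)" if x: "x \<in> A" for x
  proof -
    have "e * q (f x) \<le> (\<Sum>p\<in>F. p x)"
    proof (rule dense_ge)
      fix t assume "(\<Sum>p\<in>F. p x) < t"
      from main[OF x this] F(3) show "e * q (f x) \<le> t" by (simp add: field_simps)
    qed
    then show ?thesis using F(3) by (simp add: field_simps)
  qed
  then show ?thesis using that[of F "1/e"] F by auto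
qed

lemma dual_seminorm_nonneg:
  assumes p: "p \<in> s_dual_seminorms" and x: "\<xi> \<in> s_dual"
  shows "0 \<le> p \<xi>"
proof -
  have m: "seq_scale (-1) \<xi> \<in> s_dual" using x by (rule s_dual_scale)
  have "p (\<xi> + seq_scale (-1) \<xi>) \<le> p \<xi> + p (seq_scale (-1) \<xi>)"
    using p x m unfolding s_dual_seminorms_def by blast
  moreover have "p (seq_scale (-1) \<xi>) = p \<xi>" 
    using p x unfolding s_dual_seminorms_def by auto
  moreover have "p (seq_scale 0 \<xi>) = 0" 
    using p x unfolding s_dual_seminorms_def by auto
  moreover have "\<xi> + seq_scale (-1) \<xi> = seq_scale 0 \<xi>" by (auto simp: seq_scale_def)
  ultimately show ?thesis by simp
qed

lemma s_norm_zero [simp]: "s_norm q 0 = 0"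
  by (simp add: s_norm_def)

lemma s_norm_tri:
  assumes "\<xi> \<in> s_space" "\<eta> \<in> s_space"
  shows "s_norm q \<eta> \<le> s_norm q \<xi> + s_norm q (\<eta> - \<xi>)"
  using s_add(2)[OF assms(1) s_diff[OF assms(2,1)], of q] by (simp add: algebra_simps)

lemma seq_scale_zero [simp]: "seq_scale c 0 = 0" "seq_scale 0 \<xi> = 0" "seq_scale 1 \<xi> = \<xi>"
  by (auto simp: seq_scale_def)

lemma seq_scale_scale: "seq_scale c (seq_scale d \<xi>) = seq_scale (c * d) \<xi>"
  by (simp add: seq_scale_def mult.assoc)

lemma seq_scale_add: "seq_scale c (\<xi> + \<eta>) = seq_scale c \<xi> + seq_scale c \<eta>"
  by (auto simp: seq_scale_def algebra_simps)

lemma seq_scale_add_left: "seq_scale (c + d) \<xi> = seq_scale c \<xi> + seq_scale d \<xi>"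
  by (auto simp: seq_scale_def algebra_simps)

text \<open>Pulling a norm of \<open>s\<close> back along \<open>x\<close> gives one of the seminorms that generate the inductive limit
  topology, so boundedness on each step suffices for continuity.\<close>

lemma smooth_opsI:
  assumes ran: "\<And>\<xi>. \<xi> \<in> s_dual \<Longrightarrow> x \<xi> \<in> s_space"
    and add: "\<And>\<xi> \<eta>. \<xi> \<in> s_dual \<Longrightarrow> \<eta> \<in> s_dual \<Longrightarrow> x (\<xi> + \<eta>) = x \<xi> + x \<eta>"
    and scale: "\<And>c \<xi>. \<xi> \<in> s_dual \<Longrightarrow> x (seq_scale c \<xi>) = seq_scale c (x \<xi>)"
    and out: "\<And>\<xi>. \<xi> \<notin> s_dual \<Longrightarrow> x \<xi> = 0"
    and bound: "\<And>q r. \<exists>C. \<forall>\<xi>\<in>dual_step q. s_norm r (x \<xi>) \<le> C * dual_norm q \<xi>"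
  shows "x \<in> smooth_ops"
proof -
  have p: "(\<lambda>\<xi>. s_norm r (x \<xi>)) \<in> s_dual_seminorms" for r
    unfolding s_dual_seminorms_def
    using bound by (auto simp: add scale s_add s_scale ran)
  have "continuous_map s_dual_topology s_topology x"
    unfolding continuous_map_def
  proof (intro conjI allI impI)
    show "x \<in> topspace s_dual_topology \<rightarrow> topspace s_topology"
      using ran by (auto simp: s_dual_topology_def s_topology_def)
    fix U assume U: "openin s_topology U"
    show "openin s_dual_topology {\<xi> \<in> topspace s_dual_topology. x \<xi> \<in> U}"
      unfolding s_dual_topology_def openin_seminorm_topology
    proof (intro conjI ballI)
      fix \<xi> assume "\<xi> \<in> {\<xi> \<in> topspace (seminorm_topology s_dual s_dual_seminorms). x \<xi> \<in> U}"
      then have xi: "\<xi> \<in> s_dual" "x \<xi> \<in> U" by auto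
      then obtain F e where F: "finite F" "F \<subseteq> range s_norm" "e > 0"
        "{y \<in> s_space. \<forall>p\<in>F. p (y - x \<xi>) < e} \<subseteq> U"
        using U unfolding s_topology_def openin_seminorm_topology by blast
      define G where "G = (\<lambda>p \<xi>. p (x \<xi>)) ` F"
      have "G \<subseteq> s_dual_seminorms" using p F(2) unfolding G_def by auto
      moreover have "{\<eta> \<in> s_dual. \<forall>p\<in>G. p (\<eta> - \<xi>) < e} \<subseteq> {\<xi> \<in> s_dual. x \<xi> \<in> U}"
      proof safe
        fix \<eta> assume eta: "\<eta> \<in> s_dual" and G: "\<forall>p\<in>G. p (\<eta> - \<xi>) < e"
        have "x (\<eta> - \<xi>) = x \<eta> - x \<xi>"
          unfolding diff_eq_scale by (simp add: add scale s_dual_scale eta xi)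
        then have "x \<eta> \<in> {y \<in> s_space. \<forall>p\<in>F. p (y - x \<xi>) < e}"
          using G ran[OF eta] by (auto simp: G_def)
        then show "x \<eta> \<in> U" using F(4) by blast
      qed
      moreover have "finite G" using F(1) by (simp add: G_def)
      ultimately show "\<exists>F e. finite F \<and> F \<subseteq> s_dual_seminorms \<and> e > 0 \<and>
          {y \<in> s_dual. \<forall>p\<in>F. p (y - \<xi>) < e} \<subseteq> {\<xi> \<in> topspace (seminorm_topology s_dual s_dual_seminorms). x \<xi> \<in> U}"
        using F(3) by (auto intro!: exI[of _ G] exI[of _ e])
    qed auto
  qed
  then show ?thesis using assms by (auto simp: smooth_ops_def)
qed

lemma smooth_opsD:
  assumes x: "x \<in> smooth_ops"
  shows "\<xi> \<in> s_dual \<Longrightarrow> \<eta> \<in> s_dual \<Longrightarrow> x (\<xi> + \<eta>) = x \<xi> + x \<eta>"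
    "\<xi> \<in> s_dual \<Longrightarrow> x (seq_scale c \<xi>) = seq_scale c (x \<xi>)"
    "\<xi> \<notin> s_dual \<Longrightarrow> x \<xi> = 0" "x 0 = 0" "x \<xi> \<in> s_space"
proof -
  show "\<xi> \<in> s_dual \<Longrightarrow> \<eta> \<in> s_dual \<Longrightarrow> x (\<xi> + \<eta>) = x \<xi> + x \<eta>"
    and "\<xi> \<in> s_dual \<Longrightarrow> x (seq_scale c \<xi>) = seq_scale c (x \<xi>)"
    and out: "\<xi> \<notin> s_dual \<Longrightarrow> x \<xi> = 0"
    using x by (auto simp: smooth_ops_def)
  have "x (seq_scale 0 0) = seq_scale 0 (x 0)"
    using x s_dual_zero unfolding smooth_ops_def by blast
  then show "x 0 = 0" by simp
  have "x \<in> topspace s_dual_topology \<rightarrow> topspace s_topology"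
    using x unfolding smooth_ops_def by (simp add: continuous_map_def)
  then have "x \<xi> \<in> s_space" if "\<xi> \<in> s_dual"
    using that by (auto simp: s_dual_topology_def s_topology_def)
  then show "x \<xi> \<in> s_space" using out s_zero by metis
qed

lemma smooth_op_diff:
  assumes x: "x \<in> smooth_ops" and "\<xi> \<in> s_dual" "\<eta> \<in> s_dual"
  shows "x (\<xi> - \<eta>) = x \<xi> - x \<eta>"
  unfolding diff_eq_scale by (simp add: smooth_opsD[OF x] s_dual_scale assms)

text \<open>A smooth operator maps each step boundedly into each Hilbert space completing \<open>s\<close>, because every
  seminorm of the inductive limit is bounded on the step. Together with \<open>smooth_opsI\<close>, this replaces
  the inductive limit topology by estimates.\<close>

lemma smooth_op_bound:
  assumes x: "x \<in> smooth_ops"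
  obtains C where "0 \<le> C" "\<And>\<xi>. \<xi> \<in> dual_step q \<Longrightarrow> s_norm r (x \<xi>) \<le> C * dual_norm q \<xi>"
proof -
  have cont: "continuous_map (subtopology (seminorm_topology s_dual s_dual_seminorms) s_dual)
     (subtopology (seminorm_topology s_space (range s_norm)) s_space) x"
    using x subtopology_topspace[of "seminorm_topology s_dual s_dual_seminorms"]
      subtopology_topspace[of "seminorm_topology s_space (range s_norm)"]
    unfolding smooth_ops_def s_dual_topology_def s_topology_def by simp
  obtain F C where F: "finite F" "F \<subseteq> s_dual_seminorms" "0 < C"
    "\<And>\<xi>. \<xi> \<in> s_dual \<Longrightarrow> s_norm r (x \<xi>) \<le> C * (\<Sum>p\<in>F. p \<xi>)"
    by (rule continuous_homogeneous_bound[OF cont, where sc=seq_scale and sc'=seq_scale and q="s_norm r"])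
      (auto simp: s_dual_zero s_dual_scale smooth_opsD[OF x] dual_seminorm_nonneg s_scale s_norm_tri
        s_dual_seminorms_def intro: that)
  have "\<forall>p\<in>F. \<exists>D. \<forall>\<xi>\<in>dual_step q. p \<xi> \<le> D * dual_norm q \<xi>"
    using F(2) unfolding s_dual_seminorms_def by blast
  then obtain D where D: "\<And>p \<xi>. p \<in> F \<Longrightarrow> \<xi> \<in> dual_step q \<Longrightarrow> p \<xi> \<le> D p * dual_norm q \<xi>"
    by metis
  have "s_norm r (x \<xi>) \<le> \<bar>C * (\<Sum>p\<in>F. D p)\<bar> * dual_norm q \<xi>" if xi: "\<xi> \<in> dual_step q" for \<xi>
  proof -
    have "s_norm r (x \<xi>) \<le> C * (\<Sum>p\<in>F. p \<xi>)" using F(4) dual_step_subset[OF xi] by blast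
    also have "\<dots> \<le> C * (\<Sum>p\<in>F. D p * dual_norm q \<xi>)"
      using F(3) D xi by (intro mult_left_mono sum_mono) auto
    also have "\<dots> = (C * (\<Sum>p\<in>F. D p)) * dual_norm q \<xi>" by (simp add: sum_distrib_right)
    also have "\<dots> \<le> \<bar>C * (\<Sum>p\<in>F. D p)\<bar> * dual_norm q \<xi>"
      using dual_norm_nonneg[OF xi] by (intro mult_right_mono) auto
    finally show ?thesis .
  qed
  then show ?thesis using that by (meson abs_ge_zero)
qed

section \<open>Algebraic operations on smooth operators\<close>

lemma smooth_add:
  assumes "x \<in> smooth_ops" "y \<in> smooth_ops" shows "x + y \<in> smooth_ops"
proof (rule smooth_opsI)
  fix q r
  obtain C where C: "\<And>\<xi>. \<xi> \<in> dual_step q \<Longrightarrow> s_norm r (x \<xi>) \<le> C * dual_norm q \<xi>"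
    using smooth_op_bound[OF assms(1)] by blast
  obtain D where D: "\<And>\<xi>. \<xi> \<in> dual_step q \<Longrightarrow> s_norm r (y \<xi>) \<le> D * dual_norm q \<xi>"
    using smooth_op_bound[OF assms(2)] by blast
  have "s_norm r ((x + y) \<xi>) \<le> (C + D) * dual_norm q \<xi>" if "\<xi> \<in> dual_step q" for \<xi>
    using s_add(2)[OF smooth_opsD(5)[OF assms(1)] smooth_opsD(5)[OF assms(2)], of r \<xi> \<xi>]
      C[OF that] D[OF that] by (simp add: algebra_simps)
  then show "\<exists>C. \<forall>\<xi>\<in>dual_step q. s_norm r ((x + y) \<xi>) \<le> C * dual_norm q \<xi>" by blast
qed (simp_all add: smooth_opsD[OF assms(1)] smooth_opsD[OF assms(2)] s_add seq_scale_add)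

lemma smooth_scale:
  assumes "x \<in> smooth_ops" shows "(\<lambda>\<xi>. seq_scale c (x \<xi>)) \<in> smooth_ops"
proof (rule smooth_opsI)
  fix q r
  obtain C where C: "\<And>\<xi>. \<xi> \<in> dual_step q \<Longrightarrow> s_norm r (x \<xi>) \<le> C * dual_norm q \<xi>"
    using smooth_op_bound[OF assms(1)] by blast
  have "s_norm r (seq_scale c (x \<xi>)) \<le> (cmod c * C) * dual_norm q \<xi>" if "\<xi> \<in> dual_step q" for \<xi>
    using mult_left_mono[OF C[OF that], of "cmod c"] by (simp add: s_scale smooth_opsD[OF assms] mult.assoc)
  then show "\<exists>C. \<forall>\<xi>\<in>dual_step q. s_norm r (seq_scale c (x \<xi>)) \<le> C * dual_norm q \<xi>" by blast
qed (simp_all add: smooth_opsD[OF assms] s_scale seq_scale_add seq_scale_scale mult.commute)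

lemma smooth_diff:
  assumes "x \<in> smooth_ops" "y \<in> smooth_ops" shows "x - y \<in> smooth_ops"
proof -
  have "x - y = x + (\<lambda>\<xi>. seq_scale (-1) (y \<xi>))"
    by (intro ext) (simp add: seq_scale_def)
  then show ?thesis using smooth_add smooth_scale assms by metis
qed

lemma smooth_comp:
  assumes "x \<in> smooth_ops" "y \<in> smooth_ops" shows "x \<circ> y \<in> smooth_ops"
proof (rule smooth_opsI)
  fix q r
  obtain C where C: "0 \<le> C" "\<And>\<xi>. \<xi> \<in> dual_step 0 \<Longrightarrow> s_norm r (x \<xi>) \<le> C * dual_norm 0 \<xi>"
    using smooth_op_bound[OF assms(1)] by blast
  obtain D where D: "\<And>\<xi>. \<xi> \<in> dual_step q \<Longrightarrow> s_norm 0 (y \<xi>) \<le> D * dual_norm q \<xi>"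
    using smooth_op_bound[OF assms(2)] by blast
  have "s_norm r ((x \<circ> y) \<xi>) \<le> (C * D) * dual_norm q \<xi>" if "\<xi> \<in> dual_step q" for \<xi>
  proof -
    have "s_norm r (x (y \<xi>)) \<le> C * dual_norm 0 (y \<xi>)"
      using C(2) s_dual_step smooth_opsD(5)[OF assms(2)] by blast
    also have "\<dots> \<le> C * (D * dual_norm q \<xi>)"
      using s_dual_step(2)[OF smooth_opsD(5)[OF assms(2)], of 0 \<xi>] D[OF that] C(1)
      by (intro mult_left_mono) auto
    finally show ?thesis by (simp add: mult.assoc)
  qed
  then show "\<exists>C. \<forall>\<xi>\<in>dual_step q. s_norm r ((x \<circ> y) \<xi>) \<le> C * dual_norm q \<xi>" by blast
qed (simp_all add: smooth_opsD[OF assms(1)] smooth_opsD[OF assms(2)] s_subset_dual)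


section \<open>The operator norms\<close>

lemma op_norm_bdd:
  assumes x: "x \<in> smooth_ops"
  shows "bdd_above ((\<lambda>\<xi>. s_norm q (x \<xi>)) ` {\<xi> \<in> dual_step q. dual_norm q \<xi> \<le> 1})"
proof -
  obtain C where C: "0 \<le> C" "\<And>\<xi>. \<xi> \<in> dual_step q \<Longrightarrow> s_norm q (x \<xi>) \<le> C * dual_norm q \<xi>"
    using smooth_op_bound[OF x] by blast
  have "s_norm q (x \<xi>) \<le> C" if "\<xi> \<in> dual_step q" "dual_norm q \<xi> \<le> 1" for \<xi>
    using C(2)[OF that(1)] mult_left_mono[OF that(2) C(1)] by simp
  then show ?thesis by (intro bdd_aboveI[of _ C]) auto
qed

lemma zero_dual_step: "0 \<in> dual_step q" "dual_norm q 0 = 0"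
  by (simp_all add: dual_step_def dual_norm_def)

lemma op_norm_leI:
  assumes "\<And>\<xi>. \<xi> \<in> dual_step q \<Longrightarrow> dual_norm q \<xi> \<le> 1 \<Longrightarrow> s_norm q (x \<xi>) \<le> M"
  shows "op_norm q x \<le> M"
  unfolding op_norm_def
  by (rule cSUP_least) (use assms zero_dual_step[of q] in \<open>auto intro!: exI[of _ 0]\<close>)

lemma le_op_norm:
  assumes "x \<in> smooth_ops" "\<xi> \<in> dual_step q" "dual_norm q \<xi> \<le> 1"
  shows "s_norm q (x \<xi>) \<le> op_norm q x"
  unfolding op_norm_def
  by (rule cSUP_upper[OF _ op_norm_bdd[OF assms(1)]]) (use assms in auto)

lemma op_norm_nonneg: "x \<in> smooth_ops \<Longrightarrow> 0 \<le> op_norm q x"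
  using le_op_norm[of x 0 q] s_norm_zero smooth_opsD(4)[of x] zero_dual_step[of q] by auto

lemma s_norm_le_op_norm:
  assumes x: "x \<in> smooth_ops" and xi: "\<xi> \<in> dual_step q"
  shows "s_norm q (x \<xi>) \<le> op_norm q x * dual_norm q \<xi>"
proof (cases "dual_norm q \<xi> = 0")
  \<comment> \<open>No scaling into the unit ball is possible here, but boundedness forces the left-hand side to vanish.\<close>
  case True
  obtain C where C: "\<And>\<xi>. \<xi> \<in> dual_step q \<Longrightarrow> s_norm q (x \<xi>) \<le> C * dual_norm q \<xi>"
    using smooth_op_bound[OF x] by blast
  show ?thesis using C[OF xi] True by simp
next
  case False
  then have pos: "dual_norm q \<xi> > 0" using dual_norm_nonneg[OF xi] by simp
  define c where "c = complex_of_real (1 / dual_norm q \<xi>)"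
  have c: "cmod c = 1 / dual_norm q \<xi>" using pos unfolding c_def norm_of_real by simp
  have "s_norm q (x (seq_scale c \<xi>)) \<le> op_norm q x"
    using pos c by (intro le_op_norm x dual_scale xi) (simp add: dual_scale xi)
  then show ?thesis
    using pos by (simp add: smooth_opsD[OF x] dual_step_subset[OF xi] s_scale c field_simps)
qed

lemma op_norm_add:
  assumes "x \<in> smooth_ops" "y \<in> smooth_ops"
  shows "op_norm q (x + y) \<le> op_norm q x + op_norm q y"
proof (rule op_norm_leI)
  fix \<xi> assume xi: "\<xi> \<in> dual_step q" "dual_norm q \<xi> \<le> 1"
  have "s_norm q ((x + y) \<xi>) \<le> s_norm q (x \<xi>) + s_norm q (y \<xi>)"
    by (simp add: s_add smooth_opsD[OF assms(1)] smooth_opsD[OF assms(2)])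
  then show "s_norm q ((x + y) \<xi>) \<le> op_norm q x + op_norm q y"
    using le_op_norm[OF assms(1) xi] le_op_norm[OF assms(2) xi] by linarith
qed

lemma op_norm_tri:
  assumes "x \<in> smooth_ops" "y \<in> smooth_ops"
  shows "op_norm q y \<le> op_norm q x + op_norm q (y - x)"
  using op_norm_add[OF assms(1) smooth_diff[OF assms(2,1)], of q] by (simp add: algebra_simps)

lemma op_norm_scale_le:
  assumes "x \<in> smooth_ops"
  shows "op_norm q (\<lambda>\<xi>. seq_scale c (x \<xi>)) \<le> cmod c * op_norm q x"
proof (rule op_norm_leI)
  fix \<xi> assume xi: "\<xi> \<in> dual_step q" "dual_norm q \<xi> \<le> 1"
  show "s_norm q (seq_scale c (x \<xi>)) \<le> cmod c * op_norm q x"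
    using le_op_norm[OF assms xi] by (simp add: s_scale smooth_opsD[OF assms] mult_left_mono)
qed

lemma op_norm_zero [simp]: "op_norm q 0 = 0"
proof -
  have "(0 :: cseq \<Rightarrow> cseq) \<in> smooth_ops"
    by (rule smooth_opsI) (auto simp: s_zero intro: exI[of _ 0])
  then show ?thesis
    using op_norm_leI[of q 0 0] op_norm_nonneg[of 0 q] by auto
qed

lemma op_norm_scale:
  assumes x: "x \<in> smooth_ops"
  shows "op_norm q (\<lambda>\<xi>. seq_scale c (x \<xi>)) = cmod c * op_norm q x"
proof (cases "c = 0")
  case True
  have "(\<lambda>\<xi>. seq_scale c (x \<xi>)) = 0" by (intro ext) (simp add: True)
  then show ?thesis using True by simp
next
  case False
  have "op_norm q (\<lambda>\<xi>. seq_scale (inverse c) (seq_scale c (x \<xi>)))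
      \<le> cmod (inverse c) * op_norm q (\<lambda>\<xi>. seq_scale c (x \<xi>))"
    by (rule op_norm_scale_le[OF smooth_scale[OF x]])
  then have "op_norm q x \<le> inverse (cmod c) * op_norm q (\<lambda>\<xi>. seq_scale c (x \<xi>))"
    using False by (simp add: seq_scale_scale norm_inverse)
  then have "cmod c * op_norm q x \<le> op_norm q (\<lambda>\<xi>. seq_scale c (x \<xi>))"
    using False by (simp add: field_simps)
  then show ?thesis using op_norm_scale_le[OF x, of q c] by simp
qed

lemma op_norm_mono:
  assumes x: "x \<in> smooth_ops" and "q \<le> r"
  shows "op_norm q x \<le> op_norm r x"
proof (rule op_norm_leI)
  fix \<xi> assume xi: "\<xi> \<in> dual_step q" "dual_norm q \<xi> \<le> 1"
  have "s_norm q (x \<xi>) \<le> s_norm r (x \<xi>)" using s_norm_mono smooth_opsD(5)[OF x] assms(2) by blast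
  also have "\<dots> \<le> op_norm r x"
    using dual_step_mono[OF xi(1) assms(2)] xi(2) by (intro le_op_norm x) auto
  finally show "s_norm q (x \<xi>) \<le> op_norm r x" .
qed

section \<open>Adjoints\<close>

text \<open>Density of the finitely supported sequences in each step, as seen through a smooth operator.\<close>

lemma trunc_dual_limit:
  assumes x: "x \<in> smooth_ops" and xi: "\<xi> \<in> dual_step q"
  shows "(\<lambda>n. s_norm r (x \<xi> - x (trunc n \<xi>))) \<longlonglongrightarrow> 0"
proof -
  obtain C where C: "0 \<le> C" "\<And>\<xi>. \<xi> \<in> dual_step q \<Longrightarrow> s_norm r (x \<xi>) \<le> C * dual_norm q \<xi>"
    using smooth_op_bound[OF x] by blast
  have tr: "\<xi> - trunc n \<xi> \<in> dual_step q" "(\<lambda>n. dual_norm q (\<xi> - trunc n \<xi>)) \<longlonglongrightarrow> 0" for n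
    using xi trunc_tendsto unfolding dual_step_eq dual_norm_eq by auto
  show ?thesis
  proof (rule tendsto_sandwich[where f="\<lambda>_. 0" and h="\<lambda>n. C * dual_norm q (\<xi> - trunc n \<xi>)"])
    show "\<forall>\<^sub>F n in sequentially. 0 \<le> s_norm r (x \<xi> - x (trunc n \<xi>))"
      by (simp add: s_norm_nonneg s_diff smooth_opsD[OF x])
    have "s_norm r (x \<xi> - x (trunc n \<xi>)) \<le> C * dual_norm q (\<xi> - trunc n \<xi>)" for n
      using C(2)[OF tr(1)[of n]]
      by (simp add: smooth_op_diff[OF x] dual_step_subset[OF xi] s_subset_dual trunc_s)
    then show "\<forall>\<^sub>F n in sequentially. s_norm r (x \<xi> - x (trunc n \<xi>)) \<le> C * dual_norm q (\<xi> - trunc n \<xi>)"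
      by simp
    show "(\<lambda>n. C * dual_norm q (\<xi> - trunc n \<xi>)) \<longlonglongrightarrow> 0"
      using tendsto_mult_left[OF tr(2), of C] by simp
  qed simp
qed

text \<open>A smooth operator is determined by its columns \<open>x e\<^sub>j\<close>: by linearity this holds on truncations,
  and both sides are continuous.\<close>

lemma inner_sums_columns:
  assumes x: "x \<in> smooth_ops" and xi: "\<xi> \<in> s_dual" and eta: "\<eta> \<in> s_dual"
  shows "(\<lambda>j. \<xi> j * ell2_inner (x (unit_seq j)) \<eta>) sums ell2_inner (x \<xi>) \<eta>"
proof -
  obtain q where q: "\<xi> \<in> dual_step q" "\<eta> \<in> dual_step q" 
    using s_dual_common_step[OF xi eta] by blast
  have inner_scale: "ell2_inner (seq_scale c \<zeta>) \<eta> = c * ell2_inner \<zeta> \<eta>" 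
    and inner_add: "ell2_inner (\<zeta> + \<zeta>') \<eta> = ell2_inner \<zeta> \<eta> + ell2_inner \<zeta>' \<eta>"
    if "\<zeta> \<in> s_space" "\<zeta>' \<in> s_space" for c \<zeta> \<zeta>'
    using suminf_mult[OF s_dual_pairing(1)[OF that(1) q(2)], of c]
      suminf_add[OF s_dual_pairing(1)[OF that(1) q(2)] s_dual_pairing(1)[OF that(2) q(2)]]
    by (simp_all add: ell2_inner_def seq_scale_def mult.assoc distrib_right)
  have part: "(\<Sum>j<n. \<xi> j * ell2_inner (x (unit_seq j)) \<eta>) = ell2_inner (x (trunc n \<xi>)) \<eta>" for n
  proof (induction n)
    case 0
    have "trunc 0 \<xi> = 0" by (auto simp: trunc_def)
    with smooth_opsD(4)[OF x] have "x (trunc 0 \<xi>) = 0" by simp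
    then show ?case by (simp add: ell2_inner_def)
  next
    case (Suc n)
    have "x (trunc (Suc n) \<xi>) = x (trunc n \<xi>) + seq_scale (\<xi> n) (x (unit_seq n))"
      unfolding trunc_Suc
      using smooth_opsD(1)[OF x s_subset_dual[OF trunc_s] s_dual_scale]
        smooth_opsD(2)[OF x] s_subset_dual[OF unit_seq_s] by metis
    moreover have sp: "x (trunc n \<xi>) \<in> s_space" "x (unit_seq n) \<in> s_space"
      "seq_scale (\<xi> n) (x (unit_seq n)) \<in> s_space"
      by (simp_all add: s_scale smooth_opsD(5)[OF x])
    ultimately show ?case
      by (simp only: sum.lessThan_Suc Suc.IH inner_add[OF sp(1,3)] inner_scale[OF sp(2,2)])
  qed
  have "(\<lambda>n. ell2_inner (x \<xi>) \<eta> - ell2_inner (x (trunc n \<xi>)) \<eta>) \<longlonglongrightarrow> 0"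
  proof (rule Lim_null_comparison)
    have "cmod (ell2_inner (x \<xi>) \<eta> - ell2_inner (x (trunc n \<xi>)) \<eta>)
      \<le> s_norm q (x \<xi> - x (trunc n \<xi>)) * dual_norm q \<eta>" for n
    proof -
      have "ell2_inner (x \<xi> - x (trunc n \<xi>)) \<eta> = ell2_inner (x \<xi>) \<eta> - ell2_inner (x (trunc n \<xi>)) \<eta>"
        unfolding diff_eq_scale
        using inner_add[OF smooth_opsD(5)[OF x] s_scale(1)[OF smooth_opsD(5)[OF x]], of \<xi> "-1" "trunc n \<xi>"]
          inner_scale[OF smooth_opsD(5)[OF x] smooth_opsD(5)[OF x], of "-1" "trunc n \<xi>"] by simp
      then show ?thesis 
        using s_dual_pairing(2)[OF s_diff q(2), of "x \<xi>" "x (trunc n \<xi>)"] by (simp add: smooth_opsD[OF x])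
    qed
    then show "\<forall>\<^sub>F n in sequentially. cmod (ell2_inner (x \<xi>) \<eta> - ell2_inner (x (trunc n \<xi>)) \<eta>)
      \<le> s_norm q (x \<xi> - x (trunc n \<xi>)) * dual_norm q \<eta>" by simp
    show "(\<lambda>n. s_norm q (x \<xi> - x (trunc n \<xi>)) * dual_norm q \<eta>) \<longlonglongrightarrow> 0"
      using tendsto_mult_right[OF trunc_dual_limit[OF x q(1), of q], of "dual_norm q \<eta>"] by simp
  qed
  then have "(\<lambda>n. ell2_inner (x (trunc n \<xi>)) \<eta>) \<longlonglongrightarrow> ell2_inner (x \<xi>) \<eta>"
    using tendsto_diff[OF tendsto_const[of "ell2_inner (x \<xi>) \<eta>"]] by fastforce
  then show ?thesis unfolding sums_def part .
qed

text \<open>Uniform decay by one additional power of the index suffices for a weighted square norm, since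
  the inverse squares are summable.\<close>

lemma wnorm_decay:
  assumes M: "0 \<le> M" and le: "\<And>j. cmod (\<xi> j) * real (Suc j) ^ Suc q \<le> M"
  shows "\<xi> \<in> wspace (\<lambda>j. real (Suc j) ^ q)"
    "s_norm q \<xi> \<le> M * sqrt (\<Sum>j. 1 / real (Suc j) ^ 2)"
proof -
  have sm: "summable (\<lambda>j. 1 / real (Suc j) ^ 2)"
    using inverse_power_summable[of 2, where 'a=real] summable_Suc_iff[of "\<lambda>n. inverse (real n ^ 2)"] by (simp add: inverse_eq_divide)
  have *: "(cmod (\<xi> j) * real (Suc j) ^ q)\<^sup>2 \<le> M\<^sup>2 * (1 / real (Suc j) ^ 2)" for j
  proof -
    have "(cmod (\<xi> j) * real (Suc j) ^ Suc q)\<^sup>2 \<le> M\<^sup>2"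
      using le by (intro power_mono) auto
    moreover have "(cmod (\<xi> j) * real (Suc j) ^ Suc q)\<^sup>2 = (cmod (\<xi> j) * real (Suc j) ^ q)\<^sup>2 * real (Suc j) ^ 2"
      by (simp add: power_mult_distrib mult_ac del: of_nat_Suc)
    ultimately show ?thesis by (simp add: field_simps del: of_nat_Suc)
  qed
  have sm2: "summable (\<lambda>j. (cmod (\<xi> j) * real (Suc j) ^ q)\<^sup>2)"
    by (rule summable_comparison_test'[OF summable_mult[OF sm, of "M\<^sup>2"], of 0]) (use * in simp)
  then show "\<xi> \<in> wspace (\<lambda>j. real (Suc j) ^ q)" by (simp add: wspace_def)
  have "(\<Sum>j. (cmod (\<xi> j) * real (Suc j) ^ q)\<^sup>2) \<le> (\<Sum>j. M\<^sup>2 * (1 / real (Suc j) ^ 2))"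
    by (rule suminf_le[OF * sm2 summable_mult[OF sm]])
  also have "\<dots> = M\<^sup>2 * (\<Sum>j. 1 / real (Suc j) ^ 2)" by (rule suminf_mult[OF sm])
  finally show "s_norm q \<xi> \<le> M * sqrt (\<Sum>j. 1 / real (Suc j) ^ 2)"
    unfolding s_norm_eq wnorm_def using M real_sqrt_le_mono real_sqrt_mult real_sqrt_abs by (metis abs_of_nonneg)
qed

text \<open>The operator of the conjugate transpose of the matrix of \<open>x\<close>.\<close>

definition formal_adjoint :: "(cseq \<Rightarrow> cseq) \<Rightarrow> cseq \<Rightarrow> cseq" where
  "formal_adjoint x \<eta> = (if \<eta> \<in> s_dual then (\<lambda>j. ell2_inner \<eta> (x (unit_seq j))) else 0)"

text \<open>The entry \<open>j\<close> is a pairing with the column \<open>x e\<^sub>j\<close>, and the norms of the columns decay faster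
  than any power of \<open>j\<close>, because the dual norm of \<open>e\<^sub>j\<close> of index \<open>r\<close> is the reciprocal of the
  \<open>r\<close>-th power of \<open>Suc j\<close>.\<close>

lemma formal_adjoint_decay:
  assumes x: "x \<in> smooth_ops"
  obtains C where "0 \<le> C" 
    "\<And>\<eta> j. \<eta> \<in> dual_step q \<Longrightarrow> cmod (formal_adjoint x \<eta> j) * real (Suc j) ^ r \<le> C * dual_norm q \<eta>"
proof -
  obtain C where C: "0 \<le> C" "\<And>\<xi>. \<xi> \<in> dual_step r \<Longrightarrow> s_norm q (x \<xi>) \<le> C * dual_norm r \<xi>"
    using smooth_op_bound[OF x] by blast
  have "cmod (formal_adjoint x \<eta> j) * real (Suc j) ^ r \<le> C * dual_norm q \<eta>" if eta: "\<eta> \<in> dual_step q" for \<eta> j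
  proof -
    have "cmod (formal_adjoint x \<eta> j) \<le> dual_norm q \<eta> * s_norm q (x (unit_seq j))"
      using dual_s_pairing_bound[OF eta smooth_opsD(5)[OF x]] dual_step_subset[OF eta]
      by (simp add: formal_adjoint_def)
    also have "\<dots> \<le> dual_norm q \<eta> * (C * (1 / real (Suc j) ^ r))"
      using C(2)[OF s_dual_step(1)[OF unit_seq_s], of j] dual_norm_nonneg[OF eta]
      unfolding dual_norm_unit_seq by (intro mult_left_mono)
    finally show ?thesis by (simp add: field_simps del: of_nat_Suc)
  qed
  then show ?thesis using that C(1) by blast
qed

lemma formal_adjoint_smooth:
  assumes x: "x \<in> smooth_ops"
  shows "formal_adjoint x \<in> smooth_ops"
proof (rule smooth_opsI)
  fix \<eta> assume "\<eta> \<in> s_dual"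
  then obtain q where q: "\<eta> \<in> dual_step q" by (auto simp: s_dual_def)
  show "formal_adjoint x \<eta> \<in> s_space"
    unfolding s_space_eq
  proof safe
    fix r
    obtain C where "0 \<le> C" 
      "\<And>\<eta> j. \<eta> \<in> dual_step q \<Longrightarrow> cmod (formal_adjoint x \<eta> j) * real (Suc j) ^ Suc r \<le> C * dual_norm q \<eta>"
      using formal_adjoint_decay[OF x] by blast
    then show "formal_adjoint x \<eta> \<in> wspace (\<lambda>j. real (Suc j) ^ r)"
      using q dual_norm_nonneg[OF q] by (intro wnorm_decay(1)[where M="C * dual_norm q \<eta>"]) auto
  qed
next
  fix q r
  obtain C where C: "0 \<le> C" 
    "\<And>\<eta> j. \<eta> \<in> dual_step q \<Longrightarrow> cmod (formal_adjoint x \<eta> j) * real (Suc j) ^ Suc r \<le> C * dual_norm q \<eta>"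
    using formal_adjoint_decay[OF x] by blast
  have "s_norm r (formal_adjoint x \<eta>) \<le> (C * sqrt (\<Sum>j. 1 / real (Suc j) ^ 2)) * dual_norm q \<eta>" 
    if q: "\<eta> \<in> dual_step q" for \<eta>
    using wnorm_decay(2)[of "C * dual_norm q \<eta>" "formal_adjoint x \<eta>" r] C q dual_norm_nonneg[OF q]
    by (simp add: mult_ac)
  then show "\<exists>C. \<forall>\<xi>\<in>dual_step q. s_norm r (formal_adjoint x \<xi>) \<le> C * dual_norm q \<xi>" by blast
next
  fix \<xi> \<eta> assume "\<xi> \<in> s_dual" "\<eta> \<in> s_dual"
  then show "formal_adjoint x (\<xi> + \<eta>) = formal_adjoint x \<xi> + formal_adjoint x \<eta>"
    by (intro ext) (simp add: formal_adjoint_def s_dual_add ell2_inner_add_left smooth_opsD[OF x])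
next
  fix c \<xi> assume "\<xi> \<in> s_dual"
  then show "formal_adjoint x (seq_scale c \<xi>) = seq_scale c (formal_adjoint x \<xi>)"
    by (simp add: formal_adjoint_def s_dual_scale ell2_inner_scale_left smooth_opsD[OF x])
      (simp add: seq_scale_def)
qed (simp add: formal_adjoint_def)

lemma formal_adjoint_inner:
  assumes x: "x \<in> smooth_ops" and xi: "\<xi> \<in> s_dual" and eta: "\<eta> \<in> s_dual"
  shows "ell2_inner (x \<xi>) \<eta> = ell2_inner \<xi> (formal_adjoint x \<eta>)"
proof -
  have "ell2_inner (x (unit_seq j)) \<eta> = cnj (formal_adjoint x \<eta> j)" for j
    using ell2_inner_cnj[OF eta smooth_opsD(5)[OF x]] eta by (simp add: formal_adjoint_def)
  then have "(\<lambda>j. \<xi> j * cnj (formal_adjoint x \<eta> j)) sums ell2_inner (x \<xi>) \<eta>"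
    using inner_sums_columns[OF assms] by simp
  then show ?thesis unfolding ell2_inner_def[of \<xi>] by (simp add: sums_iff)
qed

text \<open>Pairing with unit vectors gives equality on \<^const>\<open>ell2\<close>, and density extends it to \<^const>\<open>s_dual\<close>.\<close>

lemma adjoint_unique:
  assumes y: "y \<in> smooth_ops" and z: "z \<in> smooth_ops"
    and eq: "\<And>\<xi> \<eta>. \<xi> \<in> ell2 \<Longrightarrow> \<eta> \<in> ell2 \<Longrightarrow> ell2_inner \<xi> (y \<eta>) = ell2_inner \<xi> (z \<eta>)"
  shows "y = z"
proof
  fix \<eta>
  have s: "y \<zeta> = z \<zeta>" if "\<zeta> \<in> ell2" for \<zeta>
  proof
    fix j
    have "cnj (y \<zeta> j) = cnj (z \<zeta> j)"
      using eq[OF s_ell2[OF unit_seq_s] that, of j] unfolding ell2_inner_unit_left .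
    then show "y \<zeta> j = z \<zeta> j" by simp
  qed
  show "y \<eta> = z \<eta>"
  proof (cases "\<eta> \<in> s_dual")
    case True
    then obtain q where q: "\<eta> \<in> dual_step q" by (auto simp: s_dual_def)
    have "(\<lambda>n. s_norm 0 (y \<eta> - y (trunc n \<eta>)) + s_norm 0 (z \<eta> - z (trunc n \<eta>))) \<longlonglongrightarrow> 0 + 0"
      by (intro tendsto_add trunc_dual_limit[OF y q] trunc_dual_limit[OF z q])
    moreover have "s_norm 0 (y \<eta> - z \<eta>) \<le> s_norm 0 (y \<eta> - y (trunc n \<eta>)) + s_norm 0 (z \<eta> - z (trunc n \<eta>))" for n
    proof -
      have e: "y (trunc n \<eta>) = z (trunc n \<eta>)" by (rule s[OF s_ell2[OF trunc_s]])
      have "y \<eta> - z \<eta> = (y \<eta> - y (trunc n \<eta>)) + seq_scale (-1) (z \<eta> - z (trunc n \<eta>))"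
        unfolding e by (auto simp: seq_scale_def)
      then show ?thesis
        using s_add(2)[OF s_diff s_scale(1)[OF s_diff],
            OF smooth_opsD(5)[OF y] smooth_opsD(5)[OF y] smooth_opsD(5)[OF z] smooth_opsD(5)[OF z],
            of 0 \<eta> "trunc n \<eta>" "-1" \<eta> "trunc n \<eta>"]
          s_scale(2)[OF s_diff[OF smooth_opsD(5)[OF z] smooth_opsD(5)[OF z]], of 0 "-1" \<eta> "trunc n \<eta>"]
        by (simp only: norm_minus_cancel norm_one mult_1_left)
    qed
    ultimately have "s_norm 0 (y \<eta> - z \<eta>) \<le> 0"
      by (intro LIMSEQ_le_const[where X="\<lambda>n. s_norm 0 (y \<eta> - y (trunc n \<eta>)) + s_norm 0 (z \<eta> - z (trunc n \<eta>))"]) auto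
    then have "y \<eta> - z \<eta> = 0"
      by (rule s_norm_eq_0[rotated]) (simp add: s_diff smooth_opsD[OF y] smooth_opsD[OF z])
    then show ?thesis by simp
  next
    case False
    then show ?thesis using y z smooth_opsD(3) by metis
  qed
qed

text \<open>This lemma and \<open>op_adjoint_eq\<close> discharge the definite description in the definition of the adjoint.\<close>

lemma op_adjoint_eqI:
  assumes y: "y \<in> smooth_ops" 
    and eq: "\<And>\<xi> \<eta>. \<xi> \<in> ell2 \<Longrightarrow> \<eta> \<in> ell2 \<Longrightarrow> ell2_inner (x \<xi>) \<eta> = ell2_inner \<xi> (y \<eta>)"
  shows "op_adjoint x = y"
  unfolding op_adjoint_def
  by (rule the_equality) (use assms in \<open>auto intro!: adjoint_unique\<close>)

lemma op_adjoint_eq: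
  assumes x: "x \<in> smooth_ops"
  shows "op_adjoint x = formal_adjoint x"
proof (rule op_adjoint_eqI[OF formal_adjoint_smooth[OF x]])
  fix \<xi> \<eta> assume "\<xi> \<in> ell2" "\<eta> \<in> ell2"
  then have d: "\<xi> \<in> s_dual" "\<eta> \<in> s_dual" by (simp_all add: ell2_dual)
  show "ell2_inner (x \<xi>) \<eta> = ell2_inner \<xi> (formal_adjoint x \<eta>)"
    by (rule formal_adjoint_inner[OF x d])
qed

lemma op_adjoint_smooth: "x \<in> smooth_ops \<Longrightarrow> op_adjoint x \<in> smooth_ops"
  by (simp add: op_adjoint_eq formal_adjoint_smooth)

lemma op_adjoint_inner:
  "x \<in> smooth_ops \<Longrightarrow> \<xi> \<in> s_dual \<Longrightarrow> \<eta> \<in> s_dual \<Longrightarrow> ell2_inner (x \<xi>) \<eta> = ell2_inner \<xi> (op_adjoint x \<eta>)"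
  by (simp add: op_adjoint_eq formal_adjoint_inner)

lemma op_adjoint_involution:
  assumes x: "x \<in> smooth_ops"
  shows "op_adjoint (op_adjoint x) = x"
proof (rule op_adjoint_eqI[OF x])
  fix \<xi> \<eta> assume "\<xi> \<in> ell2" "\<eta> \<in> ell2"
  then have d: "\<xi> \<in> s_dual" "\<eta> \<in> s_dual" by (simp_all add: ell2_dual)
  have "ell2_inner (op_adjoint x \<xi>) \<eta> = cnj (ell2_inner \<eta> (op_adjoint x \<xi>))"
    by (rule ell2_inner_cnj) (simp_all add: d smooth_opsD[OF op_adjoint_smooth[OF x]])
  also have "\<dots> = cnj (ell2_inner (x \<eta>) \<xi>)" using op_adjoint_inner[OF x d(2,1)] by simp
  also have "\<dots> = ell2_inner \<xi> (x \<eta>)" 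
    using ell2_inner_cnj[OF d(1) smooth_opsD(5)[OF x], of \<eta>] by simp
  finally show "ell2_inner (op_adjoint x \<xi>) \<eta> = ell2_inner \<xi> (x \<eta>)" .
qed

lemma op_adjoint_comp:
  assumes x: "x \<in> smooth_ops" and y: "y \<in> smooth_ops"
  shows "op_adjoint (x \<circ> y) = op_adjoint y \<circ> op_adjoint x"
proof (rule op_adjoint_eqI)
  show "op_adjoint y \<circ> op_adjoint x \<in> smooth_ops"
    by (intro smooth_comp op_adjoint_smooth x y)
  fix \<xi> \<eta> assume "\<xi> \<in> ell2" "\<eta> \<in> ell2"
  then have d: "\<xi> \<in> s_dual" "\<eta> \<in> s_dual" by (simp_all add: ell2_dual)
  then show "ell2_inner ((x \<circ> y) \<xi>) \<eta> = ell2_inner \<xi> ((op_adjoint y \<circ> op_adjoint x) \<eta>)"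
    by (simp add: op_adjoint_inner x y s_subset_dual smooth_opsD[OF y] smooth_opsD[OF op_adjoint_smooth[OF x]])
qed


section \<open>Rank-one projections\<close>

text \<open>The division by \<open>\<langle>f, f\<rangle>\<close> saves normalising \<open>f\<close>, which would bring in square roots.\<close>

definition rank_one_projection :: "cseq \<Rightarrow> cseq \<Rightarrow> cseq" where
  "rank_one_projection f \<xi> =
     (if \<xi> \<in> s_dual then seq_scale (ell2_inner \<xi> f / ell2_inner f f) f else 0)"

lemma rank_one_bound:
  assumes f: "f \<in> s_space" and xi: "\<xi> \<in> dual_step q"
  shows "s_norm r (rank_one_projection f \<xi>)
    \<le> (s_norm q f * s_norm r f / cmod (ell2_inner f f)) * dual_norm q \<xi>"
proof -
  have "s_norm r (rank_one_projection f \<xi>) = cmod (ell2_inner \<xi> f) * (s_norm r f / cmod (ell2_inner f f))"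
    by (simp add: rank_one_projection_def dual_step_subset[OF xi] s_scale f norm_divide)
  also have "\<dots> \<le> (dual_norm q \<xi> * s_norm q f) * (s_norm r f / cmod (ell2_inner f f))"
    by (intro mult_right_mono dual_s_pairing_bound xi f divide_nonneg_nonneg s_norm_nonneg) simp
  finally show ?thesis by (simp add: mult_ac)
qed

lemma rank_one_smooth:
  assumes f: "f \<in> s_space"
  shows "rank_one_projection f \<in> smooth_ops"
proof (rule smooth_opsI)
  fix q r
  show "\<exists>C. \<forall>\<xi>\<in>dual_step q. s_norm r (rank_one_projection f \<xi>) \<le> C * dual_norm q \<xi>"
    using rank_one_bound[OF f] by blast
next
  fix \<xi> \<eta> assume d: "\<xi> \<in> s_dual" "\<eta> \<in> s_dual"
  then show "rank_one_projection f (\<xi> + \<eta>) = rank_one_projection f \<xi> + rank_one_projection f \<eta>"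
    by (simp add: rank_one_projection_def s_dual_add ell2_inner_add_left f add_divide_distrib seq_scale_add_left)
next
  fix c \<xi> assume "\<xi> \<in> s_dual"
  then show "rank_one_projection f (seq_scale c \<xi>) = seq_scale c (rank_one_projection f \<xi>)"
    by (simp add: rank_one_projection_def s_dual_scale ell2_inner_scale_left f seq_scale_scale)
qed (auto simp: rank_one_projection_def s_scale f s_zero)

lemma rank_one_idempotent:
  assumes f: "f \<in> s_space" and nz: "ell2_inner f f \<noteq> 0"
  shows "rank_one_projection f \<circ> rank_one_projection f = rank_one_projection f"
proof
  fix \<xi>
  show "(rank_one_projection f \<circ> rank_one_projection f) \<xi> = rank_one_projection f \<xi>"
  proof (cases "\<xi> \<in> s_dual")
    case True
    have "rank_one_projection f f = f"
      using nz by (simp add: rank_one_projection_def s_subset_dual[OF f])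
    then show ?thesis
      using smooth_opsD(2)[OF rank_one_smooth[OF f] s_subset_dual[OF f]] True
      by (simp add: rank_one_projection_def[of f \<xi>])
  next
    case False
    then show ?thesis using smooth_opsD(3,4)[OF rank_one_smooth[OF f]] by simp
  qed
qed

lemma rank_one_orthogonal:
  assumes f: "f \<in> s_space" and g: "g \<in> s_space" and fg: "\<And>j. f j * cnj (g j) = 0"
  shows "rank_one_projection f \<circ> rank_one_projection g = (\<lambda>_. 0)"
proof
  fix \<xi>
  have "(\<lambda>j. g j * cnj (f j)) = (\<lambda>j. 0)" using fg by (intro ext) auto
  then have "ell2_inner g f = 0" unfolding ell2_inner_def by simp
  then have "rank_one_projection f g = 0" by (simp add: rank_one_projection_def)
  then show "(rank_one_projection f \<circ> rank_one_projection g) \<xi> = 0"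
    using smooth_opsD(2)[OF rank_one_smooth[OF f] s_subset_dual[OF g]] smooth_opsD(4)[OF rank_one_smooth[OF f]]
    by (simp add: rank_one_projection_def[of g])
qed

lemma rank_one_self_adjoint:
  assumes f: "f \<in> s_space"
  shows "op_adjoint (rank_one_projection f) = rank_one_projection f"
proof (rule op_adjoint_eqI[OF rank_one_smooth[OF f]])
  fix \<xi> \<eta> assume "\<xi> \<in> ell2" "\<eta> \<in> ell2"
  then have d: "\<xi> \<in> s_dual" "\<eta> \<in> s_dual" by (simp_all add: ell2_dual)
  let ?N = "ell2_inner f f"
  have N: "cnj ?N = ?N" using ell2_inner_cnj[OF s_subset_dual[OF f] f] by simp
  have left: "ell2_inner (seq_scale c f) \<zeta> = c * ell2_inner f \<zeta>" if \<zeta>: "\<zeta> \<in> s_dual" for c \<zeta>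
  proof -
    obtain q where "\<zeta> \<in> dual_step q" using \<zeta> by (auto simp: s_dual_def)
    from suminf_mult[OF s_dual_pairing(1)[OF f this], of c] show ?thesis
      by (simp add: ell2_inner_def seq_scale_def mult.assoc)
  qed
  have right: "ell2_inner \<xi> (seq_scale c f) = cnj c * ell2_inner \<xi> f" for c
  proof -
    have "cnj (ell2_inner \<xi> (seq_scale c f)) = ell2_inner (seq_scale c f) \<xi>"
      by (rule ell2_inner_cnj[OF d(1) s_scale(1)[OF f], symmetric])
    also have "\<dots> = c * cnj (ell2_inner \<xi> f)"
      by (simp only: left[OF d(1)] ell2_inner_cnj[OF d(1) f])
    also have "\<dots> = cnj (cnj c * ell2_inner \<xi> f)" by simp
    finally show ?thesis by (simp only: complex_cnj_cancel_iff)
  qed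
  show "ell2_inner (rank_one_projection f \<xi>) \<eta> = ell2_inner \<xi> (rank_one_projection f \<eta>)"
    using d N ell2_inner_cnj[OF d(2) f] by (simp add: rank_one_projection_def left[OF d(2)] right)
qed

lemma rank_one_op_norm_le:
  assumes f: "f \<in> s_space"
  shows "op_norm q (rank_one_projection f) \<le> (s_norm q f)\<^sup>2 / cmod (ell2_inner f f)"
proof (rule op_norm_leI)
  fix \<xi> assume xi: "\<xi> \<in> dual_step q" "dual_norm q \<xi> \<le> 1"
  have "s_norm q (rank_one_projection f \<xi>) \<le> ((s_norm q f)\<^sup>2 / cmod (ell2_inner f f)) * dual_norm q \<xi>"
    using rank_one_bound[OF f xi(1), of q] by (simp add: power2_eq_square)
  also have "\<dots> \<le> ((s_norm q f)\<^sup>2 / cmod (ell2_inner f f)) * 1"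
    using xi(2) by (intro mult_left_mono) auto
  finally show "s_norm q (rank_one_projection f \<xi>) \<le> (s_norm q f)\<^sup>2 / cmod (ell2_inner f f)" by simp
qed

text \<open>Test the operator on the unit vector at \<open>b\<close>, whose dual norm is the reciprocal of the weight.\<close>

lemma rank_one_op_norm_ge:
  assumes f: "f \<in> s_space"
  shows "(cmod (f b) * real (Suc b) ^ q)\<^sup>2 / cmod (ell2_inner f f) \<le> op_norm q (rank_one_projection f)"
proof -
  let ?e = "unit_seq b" and ?B = "real (Suc b) ^ q"
  have pos: "?B > 0" by simp
  have e: "?e \<in> dual_step q" by (rule s_dual_step(1)[OF unit_seq_s])
  have "cmod (f b) / cmod (ell2_inner f f) * s_norm q f = s_norm q (rank_one_projection f ?e)"
    by (simp add: rank_one_projection_def dual_step_subset[OF e] s_scale f ell2_inner_unit_left norm_divide)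
  also have "\<dots> \<le> op_norm q (rank_one_projection f) * (1 / ?B)"
    using s_norm_le_op_norm[OF rank_one_smooth[OF f] e] by (simp only: dual_norm_unit_seq)
  finally have "cmod (f b) / cmod (ell2_inner f f) * s_norm q f * ?B \<le> op_norm q (rank_one_projection f)"
    using pos by (simp only: pos_le_divide_eq[symmetric] times_divide_eq_right mult_1_right)
  moreover have "cmod (f b) / cmod (ell2_inner f f) * (cmod (f b) * ?B) * ?B
      \<le> cmod (f b) / cmod (ell2_inner f f) * s_norm q f * ?B"
    using s_coord_le[OF f, of b q] by (intro mult_right_mono mult_left_mono) auto
  ultimately show ?thesis by (simp add: power2_eq_square mult_ac del: of_nat_Suc)
qed

section \<open>The bicommutant algebra\<close>

definition commutant :: "(cseq \<Rightarrow> cseq) set \<Rightarrow> (cseq \<Rightarrow> cseq) set" where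
  "commutant S = {x \<in> smooth_ops. \<forall>y\<in>S. x \<circ> y = y \<circ> x}"

text \<open>The commutator with a fixed \<open>y\<close>, applied to a fixed \<open>\<xi>\<close>, is a continuous function of \<open>x\<close>. So if it
  does not vanish at \<open>x\<close>, it does not vanish near \<open>x\<close>.\<close>

lemma closedin_commutant:
  assumes S: "S \<subseteq> smooth_ops"
  shows "closedin (topo smooth_op_algebra) (commutant S)"
proof -
  have "openin (seminorm_topology smooth_ops (range op_norm)) (smooth_ops - commutant S)"
    unfolding openin_seminorm_topology
  proof (intro conjI ballI)
    fix x assume "x \<in> smooth_ops - commutant S"
    then obtain y \<xi> where x: "x \<in> smooth_ops" and y: "y \<in> S" and ne: "x (y \<xi>) \<noteq> y (x \<xi>)"
      unfolding commutant_def by (auto simp: fun_eq_iff)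
    have ys: "y \<in> smooth_ops" using y S by blast
    have "\<xi> \<in> s_dual"
      using ne smooth_opsD(3,4)[OF x] smooth_opsD(3,4)[OF ys] by metis
    then obtain q where q: "\<xi> \<in> dual_step q" by (auto simp: s_dual_def)
    obtain C where C: "0 \<le> C" "\<And>\<xi>. \<xi> \<in> dual_step 0 \<Longrightarrow> s_norm 0 (y \<xi>) \<le> C * dual_norm 0 \<xi>"
      using smooth_op_bound[OF ys] by blast
    define d where "d = s_norm 0 (x (y \<xi>) - y (x \<xi>))"
    define K where "K = dual_norm q (y \<xi>) + C * dual_norm q \<xi>"
    have yq: "y \<xi> \<in> dual_step q" by (rule s_dual_step(1)[OF smooth_opsD(5)[OF ys]])
    have K: "0 \<le> K" unfolding K_def by (intro add_nonneg_nonneg mult_nonneg_nonneg dual_norm_nonneg q yq C)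
    have sp: "x (y \<xi>) - y (x \<xi>) \<in> s_space" by (intro s_diff smooth_opsD(5) x ys)
    have d: "d > 0"
      using s_norm_eq_0[OF sp, of 0] ne unfolding d_def by force
    have key: "d \<le> K * op_norm q (z - x)" if z: "z \<in> smooth_ops" and zc: "z (y \<xi>) = y (z \<xi>)" for z
    proof -
      define u where "u = z - x"
      have u: "u \<in> smooth_ops" unfolding u_def by (rule smooth_diff[OF z x])
      have "y (u \<xi>) = y (z \<xi>) - y (x \<xi>)"
        unfolding u_def fun_diff_def[of z x]
        by (rule smooth_op_diff[OF ys]) (intro s_subset_dual smooth_opsD(5) x z)+
      moreover have "u (y \<xi>) = z (y \<xi>) - x (y \<xi>)" by (simp add: u_def fun_diff_def)
      ultimately have "x (y \<xi>) - y (x \<xi>) = y (u \<xi>) + seq_scale (-1) (u (y \<xi>))"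
        using zc unfolding diff_eq_scale[symmetric] by (simp add: algebra_simps)
      then have "d \<le> s_norm 0 (y (u \<xi>)) + s_norm 0 (u (y \<xi>))"
        unfolding d_def
        using s_add(2)[OF smooth_opsD(5)[OF ys] s_scale(1)[OF smooth_opsD(5)[OF u]], of 0 "u \<xi>" "-1" "y \<xi>"]
          s_scale(2)[OF smooth_opsD(5)[OF u], of 0 "-1" "y \<xi>"] by simp
      also have "s_norm 0 (y (u \<xi>)) \<le> C * dual_norm 0 (u \<xi>)"
        by (rule C(2)[OF s_dual_step(1)[OF smooth_opsD(5)[OF u]]])
      also have "\<dots> \<le> C * s_norm q (u \<xi>)"
        using s_dual_step(2)[OF smooth_opsD(5)[OF u], of 0 \<xi>] s_norm_mono[OF smooth_opsD(5)[OF u], of 0 q \<xi>] C(1)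
        by (intro mult_left_mono) auto
      also have "\<dots> \<le> C * (op_norm q u * dual_norm q \<xi>)"
        by (intro mult_left_mono s_norm_le_op_norm u q C)
      also have "s_norm 0 (u (y \<xi>)) \<le> s_norm q (u (y \<xi>))"
        by (rule s_norm_mono[OF smooth_opsD(5)[OF u]]) simp
      also have "\<dots> \<le> op_norm q u * dual_norm q (y \<xi>)" by (rule s_norm_le_op_norm[OF u yq])
      finally have "d \<le> K * op_norm q u" unfolding K_def by (simp add: algebra_simps)
      then show ?thesis unfolding u_def .
    qed
    \<comment> \<open>The additional 1 covers the case \<open>K = 0\<close>.\<close>
    define e where "e = d / (K + 1)"
    have "{z \<in> smooth_ops. \<forall>p\<in>{op_norm q}. p (z - x) < e} \<subseteq> smooth_ops - commutant S"
    proof safe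
      fix z assume z: "z \<in> smooth_ops" and lt: "\<forall>p\<in>{op_norm q}. p (z - x) < e" and zc: "z \<in> commutant S"
      have "z (y \<xi>) = y (z \<xi>)" using zc y unfolding commutant_def by (auto simp: fun_eq_iff o_def)
      then have "d \<le> K * op_norm q (z - x)" by (rule key[OF z])
      also have "\<dots> \<le> K * e" using lt K by (intro mult_left_mono) auto
      also have "\<dots> < d" using d K by (simp add: e_def field_simps)
      finally show False by simp
    qed
    moreover have "e > 0" using d K by (simp add: e_def)
    ultimately show "\<exists>F e. finite F \<and> F \<subseteq> range op_norm \<and> e > 0 \<and>
        {z \<in> smooth_ops. \<forall>p\<in>F. p (z - x) < e} \<subseteq> smooth_ops - commutant S"
      by (intro exI[of _ "{op_norm q}"] exI[of _ e]) auto
  qed auto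
  then show ?thesis
    by (auto simp: closedin_def smooth_op_algebra_def commutant_def)
qed

lemma commutant_star:
  assumes S: "S \<subseteq> smooth_ops" and star: "\<And>y. y \<in> S \<Longrightarrow> op_adjoint y \<in> S" and x: "x \<in> commutant S"
  shows "op_adjoint x \<in> commutant S"
proof -
  have xs: "x \<in> smooth_ops" using x by (simp add: commutant_def)
  have "op_adjoint x \<circ> y = y \<circ> op_adjoint x" if y: "y \<in> S" for y
  proof -
    have ys: "y \<in> smooth_ops" using y S by blast
    have "x \<circ> op_adjoint y = op_adjoint y \<circ> x" using x star[OF y] by (simp add: commutant_def)
    then have "op_adjoint (x \<circ> op_adjoint y) = op_adjoint (op_adjoint y \<circ> x)" by simp
    then show ?thesis
      by (simp add: op_adjoint_comp xs op_adjoint_smooth ys op_adjoint_involution)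
  qed
  then show ?thesis by (simp add: commutant_def op_adjoint_smooth xs)
qed

lemma closed_star_subalgebra_commutant:
  assumes S: "S \<subseteq> smooth_ops" and star: "\<And>y. y \<in> S \<Longrightarrow> op_adjoint y \<in> S"
  shows "closed_star_subalgebra smooth_op_algebra (commutant S)"
  unfolding closed_star_subalgebra_def
proof (intro conjI ballI allI)
  show "closedin (topo smooth_op_algebra) (commutant S)" by (rule closedin_commutant[OF S])
  have z: "(\<lambda>_. 0) \<in> smooth_ops"
    by (rule smooth_opsI) (auto simp: s_zero intro: exI[of _ 0])
  have "(\<lambda>_. 0) \<in> commutant S"
    unfolding commutant_def mem_Collect_eq
  proof (intro conjI ballI z)
    fix y assume "y \<in> S"
    then show "(\<lambda>_. 0) \<circ> y = y \<circ> (\<lambda>_. 0)" using smooth_opsD(4)[of y] S by auto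
  qed
  then show "commutant S \<noteq> {}" by blast
next
  fix x assume x: "x \<in> commutant S"
  show "star smooth_op_algebra x \<in> commutant S"
    using commutant_star[OF S star x] by (simp add: smooth_op_algebra_def)
  fix c
  have "(\<lambda>\<xi>. seq_scale c (x \<xi>)) \<circ> y = y \<circ> (\<lambda>\<xi>. seq_scale c (x \<xi>))" if y: "y \<in> S" for y
  proof
    fix \<xi>
    have ys: "y \<in> smooth_ops" using y S by blast
    have "x (y \<xi>) = y (x \<xi>)" using x y by (auto simp: commutant_def fun_eq_iff o_def)
    then show "((\<lambda>\<xi>. seq_scale c (x \<xi>)) \<circ> y) \<xi> = (y \<circ> (\<lambda>\<xi>. seq_scale c (x \<xi>))) \<xi>"
      using x by (simp add: smooth_opsD(2)[OF ys] s_subset_dual smooth_opsD(5) commutant_def)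
  qed
  then show "scale smooth_op_algebra c x \<in> commutant S"
    using x by (simp add: commutant_def smooth_op_algebra_def smooth_scale)
next
  fix x x' assume x: "x \<in> commutant S" and x': "x' \<in> commutant S"
  have xs: "x \<in> smooth_ops" "x' \<in> smooth_ops" using x x' by (simp_all add: commutant_def)
  have "(x + x') \<circ> y = y \<circ> (x + x')" if y: "y \<in> S" for y
  proof
    fix \<xi>
    have ys: "y \<in> smooth_ops" using y S by blast
    have "x (y \<xi>) = y (x \<xi>)" "x' (y \<xi>) = y (x' \<xi>)"
      using x x' y by (auto simp: commutant_def fun_eq_iff o_def)
    then show "((x + x') \<circ> y) \<xi> = (y \<circ> (x + x')) \<xi>"
      using smooth_opsD(1)[OF ys, of "x \<xi>" "x' \<xi>"]
      by (simp add: s_subset_dual smooth_opsD(5)[OF xs(1)] smooth_opsD(5)[OF xs(2)])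
  qed
  then show "x + x' \<in> commutant S" by (simp add: commutant_def smooth_add xs)
  have "(x \<circ> x') \<circ> y = y \<circ> (x \<circ> x')" if y: "y \<in> S" for y
    using x x' y unfolding commutant_def by (metis (mono_tags, lifting) comp_assoc mem_Collect_eq)
  then show "mult smooth_op_algebra x x' \<in> commutant S"
    by (simp add: commutant_def smooth_comp xs smooth_op_algebra_def)
qed

text \<open>Since \<open>S\<close> commutes, it lies in its commutant. Taking commutants reverses inclusions, so the
  bicommutant lies in the commutant, whose elements commute with the bicommutant.\<close>

lemma bicommutant_commutative:
  assumes S: "S \<subseteq> smooth_ops" and comm: "\<And>x y. x \<in> S \<Longrightarrow> y \<in> S \<Longrightarrow> x \<circ> y = y \<circ> x"
    and "x \<in> commutant (commutant S)" "y \<in> commutant (commutant S)"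
  shows "x \<circ> y = y \<circ> x"
proof -
  have "S \<subseteq> commutant S" using S comm by (auto simp: commutant_def)
  then have "y \<in> commutant S" using assms(4) by (auto simp: commutant_def)
  then show ?thesis using assms(3) by (auto simp: commutant_def)
qed

lemma subset_bicommutant: "S \<subseteq> smooth_ops \<Longrightarrow> S \<subseteq> commutant (commutant S)"
  by (auto simp: commutant_def)

section \<open>Idempotents in s\<close>

text \<open>The entries of \<open>e\<close> are 0 or 1. Wherever \<open>e\<close> does not vanish, the weight \<open>Suc j\<close> is at most the norm
  of index 1, so all but one of the \<open>r\<close> factors of the weight can be estimated by it.\<close>

lemma s_idempotent_norm:
  assumes e: "e \<in> s_space" and idem: "e * e = e" and r: "1 \<le> r"
  shows "s_norm r e \<le> s_norm 1 e ^ r"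
proof -
  let ?S = "(s_norm 1 e)\<^sup>2"
  have sm: "summable (\<lambda>j. (cmod (e j) * real (Suc j) ^ q)\<^sup>2)" for q
    using s_spaceD[OF e, of q] by (simp add: wspace_def)
  have sq: "(s_norm q e)\<^sup>2 = (\<Sum>j. (cmod (e j) * real (Suc j) ^ q)\<^sup>2)" for q
    unfolding s_norm_eq wnorm_def by (intro real_sqrt_pow2 suminf_nonneg sm) simp
  have weight_le: "(cmod (e j) * real (Suc j) ^ r)\<^sup>2 \<le> ?S ^ (r - 1) * (cmod (e j) * real (Suc j) ^ 1)\<^sup>2" for j
  proof -
    have "e j * e j = e j" using fun_cong[OF idem, of j] by simp
    then consider "e j = 0" | "e j = 1" by auto
    then show ?thesis
    proof cases
      case 2
      have "real (Suc j) \<le> s_norm 1 e" using s_coord_le[OF e, of j 1] 2 by simp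
      then have "real (Suc j) ^ (2 * (r - 1)) \<le> s_norm 1 e ^ (2 * (r - 1))" by (intro power_mono) auto
      then have "real (Suc j) ^ (2 * (r - 1)) * real (Suc j) ^ 2 \<le> s_norm 1 e ^ (2 * (r - 1)) * real (Suc j) ^ 2"
        by (intro mult_right_mono) auto
      moreover have "2 * (r - 1) + 2 = r * 2" using r by simp
      ultimately show ?thesis
        using 2 by (simp only: power_add[symmetric] power_mult[symmetric] norm_one mult_1_left power_one_right)
    qed auto
  qed
  have "(s_norm r e)\<^sup>2 \<le> (\<Sum>j. ?S ^ (r - 1) * (cmod (e j) * real (Suc j) ^ 1)\<^sup>2)"
    unfolding sq[of r] by (rule suminf_le[OF weight_le sm summable_mult[OF sm]])
  also have "\<dots> = ?S ^ (r - 1) * ?S" unfolding sq[of 1] by (rule suminf_mult[OF sm])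
  also have "\<dots> = (s_norm 1 e ^ r)\<^sup>2"
  proof -
    have "?S ^ (r - 1) * ?S = ?S ^ r" using r by (simp add: power_eq_if)
    then show ?thesis by (simp add: power_mult[symmetric] mult.commute)
  qed
  finally show ?thesis
    by (rule power2_le_imp_le) (simp add: s_norm_nonneg e)
qed


section \<open>A sequence of test vectors\<close>

text \<open>The supports \<open>{low k, high k}\<close> must be pairwise disjoint, hence the parities.\<close>

definition low :: "nat \<Rightarrow> nat" where "low k = 2 * k"

definition high :: "nat \<Rightarrow> nat" where "high k = 2 * 2 ^ k + 1"

text \<open>Each level \<open>p\<close> is attained for infinitely many \<open>k\<close>, so a single sequence defeats every norm index.\<close>

definition level :: "nat \<Rightarrow> nat" where "level k = fst (prod_decode k)"

text \<open>The second entry is as large as it may be without affecting the order of the norm of index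
  \<open>level k\<close>: there its contribution is exactly 1.\<close>

definition test_vector :: "nat \<Rightarrow> cseq" where
  "test_vector k = (\<lambda>j. if j = low k then 1
     else if j = high k then complex_of_real (1 / real (Suc (high k)) ^ level k) else 0)"

lemma low_neq_high: "low k \<noteq> high l"
  unfolding low_def high_def by presburger

lemma test_vector_suminf:
  fixes g :: "nat \<Rightarrow> 'a::real_normed_vector"
  assumes "\<And>j. test_vector k j = 0 \<Longrightarrow> g j = 0"
  shows "(\<Sum>j. g j) = g (low k) + g (high k)"
proof -
  have "(\<Sum>j. g j) = (\<Sum>j\<in>{low k, high k}. g j)"
  proof (rule suminf_finite)
    fix j assume "j \<notin> {low k, high k}"
    then show "g j = 0" by (intro assms) (simp add: test_vector_def)
  qed simp
  then show ?thesis using low_neq_high[of k k] by simp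
qed

lemma test_vector_s: "test_vector k \<in> s_space"
  unfolding s_space_def mem_Collect_eq
  by (intro allI summable_finite[of "{low k, high k}"]) (auto simp: test_vector_def)

lemma test_vector_orthogonal:
  assumes "k \<noteq> l" shows "test_vector k j * cnj (test_vector l j) = 0"
proof -
  have "low k \<noteq> low l" "high k \<noteq> high l" using assms by (auto simp: low_def high_def)
  then show ?thesis using low_neq_high[of k l] low_neq_high[of l k] by (auto simp: test_vector_def)
qed

lemma test_vector_inner:
  "ell2_inner (test_vector k) (test_vector k) = complex_of_real (1 + (1 / real (Suc (high k)) ^ level k)\<^sup>2)"
  unfolding ell2_inner_def
  by (subst test_vector_suminf[of k])
    (use low_neq_high[of k k] in \<open>auto simp: test_vector_def power2_eq_square simp del: of_nat_Suc\<close>)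

lemma test_vector_norm_level:
  "(s_norm (level k) (test_vector k))\<^sup>2 = real (2 * k + 1) ^ (2 * level k) + 1"
proof -
  let ?g = "\<lambda>j. (cmod (test_vector k j) * real (Suc j) ^ level k)\<^sup>2"
  have "(s_norm (level k) (test_vector k))\<^sup>2 = (\<Sum>j. ?g j)"
    unfolding s_norm_eq wnorm_def
    using s_spaceD[OF test_vector_s, of k "level k"]
    by (intro real_sqrt_pow2 suminf_nonneg) (simp_all add: wspace_def)
  also have "\<dots> = ?g (low k) + ?g (high k)" by (rule test_vector_suminf) simp
  also have "\<dots> = real (2 * k + 1) ^ (2 * level k) + 1"
  proof -
    have "cmod (test_vector k (high k)) = 1 / real (Suc (high k)) ^ level k"
      using low_neq_high[of k k] unfolding test_vector_def by (simp del: of_nat_Suc add: norm_divide norm_power)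
    then have "?g (high k) = 1" by (simp del: of_nat_Suc)
    moreover have "?g (low k) = real (2 * k + 1) ^ (2 * level k)"
      by (simp add: test_vector_def low_def power_mult[symmetric] mult.commute)
    ultimately show ?thesis by simp
  qed
  finally show ?thesis .
qed

definition test_projection :: "nat \<Rightarrow> cseq \<Rightarrow> cseq" where
  "test_projection k = rank_one_projection (test_vector k)"

lemma test_projection_smooth: "test_projection k \<in> smooth_ops"
  unfolding test_projection_def by (rule rank_one_smooth[OF test_vector_s])

lemma test_inner_bounds: 
  "1 \<le> cmod (ell2_inner (test_vector k) (test_vector k))" 
  "cmod (ell2_inner (test_vector k) (test_vector k)) \<le> 2"
proof -
  have "1 / real (Suc (high k)) ^ level k \<le> 1" by (simp add: one_le_power)
  then have "(1 / real (Suc (high k)) ^ level k)\<^sup>2 \<le> 1" by (intro power_le_one) auto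
  then show "1 \<le> cmod (ell2_inner (test_vector k) (test_vector k))" 
    "cmod (ell2_inner (test_vector k) (test_vector k)) \<le> 2"
    unfolding test_vector_inner norm_of_real by (simp_all del: of_nat_Suc)
qed

lemma test_projection_idempotent: "test_projection k \<circ> test_projection k = test_projection k"
  unfolding test_projection_def
  by (rule rank_one_idempotent[OF test_vector_s]) (use test_inner_bounds(1)[of k] in auto)

lemma test_projection_norm_le:
  "op_norm (level k) (test_projection k) \<le> real (2 * k + 1) ^ (2 * level k) + 1"
proof -
  have "op_norm (level k) (test_projection k)
      \<le> (real (2 * k + 1) ^ (2 * level k) + 1) / cmod (ell2_inner (test_vector k) (test_vector k))"
    using rank_one_op_norm_le[OF test_vector_s, of "level k" k]
    unfolding test_projection_def test_vector_norm_level .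
  also have "\<dots> \<le> (real (2 * k + 1) ^ (2 * level k) + 1) / 1"
    using test_inner_bounds(1)[of k] by (intro divide_left_mono) (auto intro: add_nonneg_nonneg)
  finally show ?thesis by simp
qed

lemma test_projection_norm_ge:
  "(2 ^ k)\<^sup>2 / 2 \<le> op_norm (Suc (level k)) (test_projection k)"
proof -
  let ?f = "test_vector k" and ?B = "real (Suc (high k))"
  have B: "2 ^ k \<le> ?B" by (simp add: high_def)
  have "cmod (?f (high k)) = 1 / ?B ^ level k"
    using low_neq_high[of k k] unfolding test_vector_def by (simp del: of_nat_Suc add: norm_divide norm_power)
  then have eq: "cmod (?f (high k)) * ?B ^ Suc (level k) = ?B" by (simp del: of_nat_Suc)
  have "(2 ^ k)\<^sup>2 / 2 \<le> ?B\<^sup>2 / 2" using B by (intro divide_right_mono power_mono) auto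
  also have "\<dots> \<le> ?B\<^sup>2 / cmod (ell2_inner ?f ?f)"
    using test_inner_bounds[of k] by (intro divide_left_mono) (auto intro: mult_pos_pos)
  also have "\<dots> \<le> op_norm (Suc (level k)) (test_projection k)"
    using rank_one_op_norm_ge[OF test_vector_s, of k "high k" "Suc (level k)"]
    unfolding test_projection_def eq .
  finally show ?thesis .
qed

text \<open>The left-hand side grows at least like \<open>4\<^sup>k\<close>, the right-hand side is polynomial in \<open>k\<close>.\<close>

lemma test_projection_not_tame:
  "\<not> (\<forall>k. level k = p \<longrightarrow>
     op_norm (Suc p) (test_projection k) \<le> D * (C * op_norm p (test_projection k)) ^ r)" 
  if C: "0 \<le> C" and D: "0 \<le> D"
proof
  assume H: "\<forall>k. level k = p \<longrightarrow>
     op_norm (Suc p) (test_projection k) \<le> D * (C * op_norm p (test_projection k)) ^ r"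
  define N where "N = (2 * p + 1) * r"
  have le: "(2 ^ k)\<^sup>2 / 2 \<le> D * C ^ r * real (2 * k + 2) ^ N" if k: "level k = p" for k
  proof -
    have "real (2 * k + 1) ^ (2 * p) + 1 \<le> real (2 * k + 2) ^ (2 * p) + real (2 * k + 2) ^ (2 * p)"
      by (intro add_mono power_mono one_le_power) auto
    also have "\<dots> = 2 * real (2 * k + 2) ^ (2 * p)" by simp
    also have "\<dots> \<le> real (2 * k + 2) * real (2 * k + 2) ^ (2 * p)" by (intro mult_right_mono) auto
    finally have "op_norm p (test_projection k) \<le> real (2 * k + 2) ^ (2 * p + 1)"
      using test_projection_norm_le[of k] k by simp
    then have "D * (C * op_norm p (test_projection k)) ^ r \<le> D * (C * real (2 * k + 2) ^ (2 * p + 1)) ^ r"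
      using C D op_norm_nonneg[OF test_projection_smooth]
      by (intro mult_left_mono power_mono mult_nonneg_nonneg) auto
    also have "\<dots> = D * C ^ r * real (2 * k + 2) ^ N"
      by (simp only: N_def power_mult_distrib power_mult[symmetric] mult.assoc)
    finally show ?thesis using test_projection_norm_ge[of k] H k by force
  qed
  have "(\<lambda>k. D * C ^ r * real (2 * k + 2) ^ N / ((2 ^ k)\<^sup>2 / 2)) \<longlonglongrightarrow> 0"
    by real_asymp
  then have "\<forall>\<^sub>F k in sequentially. D * C ^ r * real (2 * k + 2) ^ N / ((2 ^ k)\<^sup>2 / 2) < 1"
    by (rule order_tendstoD) simp
  then obtain m where m: "\<And>k. k \<ge> m \<Longrightarrow> D * C ^ r * real (2 * k + 2) ^ N / ((2 ^ k)\<^sup>2 / 2) < 1"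
    by (auto simp: eventually_sequentially)
  define k where "k = prod_encode (p, m)"
  have "level k = p" by (simp add: level_def k_def)
  moreover have "k \<ge> m" unfolding k_def by (rule le_prod_encode_2)
  ultimately show False using le[of k] m[of k] by (simp add: field_simps)
qed

section \<open>Isomorphisms to subalgebras of s\<close>

text \<open>Continuity estimates involve a finite set of seminorms; this reduces them to one norm index.\<close>

lemma finite_sum_le_graded:
  fixes N :: "nat \<Rightarrow> 'a \<Rightarrow> real"
  assumes "finite F" "F \<subseteq> range N"
  shows "\<exists>n. \<forall>x. mono (\<lambda>q. N q x) \<longrightarrow> (\<Sum>p\<in>F. p x) \<le> real (card F) * N n x"
proof -
  obtain I where I: "finite I" "F = N ` I" using finite_subset_image[OF assms] by auto
  have "(\<Sum>p\<in>F. p x) \<le> real (card F) * N (Max (insert 0 I)) x" if m: "mono (\<lambda>q. N q x)" for x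
  proof (rule sum_bounded_above)
    fix p assume "p \<in> F"
    then obtain i where "i \<in> I" "p = N i" using I by blast
    then show "p x \<le> N (Max (insert 0 I)) x" using I monoD[OF m, of i] by simp
  qed
  then show ?thesis by auto
qed

text \<open>Both bounds are instances of \<open>continuous_homogeneous_bound\<close>, because the inverse of a homogeneous
  homeomorphism is homogeneous as well.\<close>

lemma isomorphism_bounds:
  assumes A: "closed_star_subalgebra smooth_op_algebra A"
    and B: "closed_star_subalgebra s_algebra B"
    and iso: "top_star_isomorphism (restrict_algebra smooth_op_algebra A) (restrict_algebra s_algebra B) \<phi>"
  shows "\<exists>p C. 0 \<le> C \<and> (\<forall>x\<in>A. s_norm q (\<phi> x) \<le> C * op_norm p x)"
    and "\<exists>r D. 0 \<le> D \<and> (\<forall>x\<in>A. op_norm t x \<le> D * s_norm r (\<phi> x))"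
proof -
  let ?sc = "\<lambda>c x \<xi>. seq_scale c ((x :: cseq \<Rightarrow> cseq) \<xi>)"
  have AX: "A \<subseteq> smooth_ops" and A0: "A \<noteq> {}" and Asc: "x \<in> A \<Longrightarrow> ?sc c x \<in> A" for c x
    using A closedin_subset[of "topo smooth_op_algebra" A]
    by (auto simp: closed_star_subalgebra_def smooth_op_algebra_def)
  have BY: "B \<subseteq> s_space" and B0: "B \<noteq> {}" and Bsc: "y \<in> B \<Longrightarrow> seq_scale c y \<in> B" for c y
    using B closedin_subset[of "topo s_algebra" B]
    by (auto simp: closed_star_subalgebra_def s_algebra_def s_topology_def)
  have zero: "?sc 0 x = 0" for x by (intro ext) simp
  have A0: "0 \<in> A" using A0 Asc[of _ 0] zero by (metis ex_in_conv)
  have B0: "0 \<in> B" using B0 Bsc[of _ 0] by (metis ex_in_conv seq_scale_zero(2))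
  let ?TA = "subtopology (seminorm_topology smooth_ops (range op_norm)) A"
  let ?TB = "subtopology (seminorm_topology s_space (range s_norm)) B"
  have tops: "topspace ?TA = A" "topspace ?TB = B" using AX BY by auto
  have homeo: "homeomorphic_map ?TA ?TB \<phi>"
    and hom: "\<And>c x. x \<in> A \<Longrightarrow> \<phi> (?sc c x) = seq_scale c (\<phi> x)"
    using iso AX
    unfolding top_star_isomorphism_def restrict_algebra_def smooth_op_algebra_def s_algebra_def s_topology_def
    by auto
  obtain \<psi> where maps: "homeomorphic_maps ?TA ?TB \<phi> \<psi>" using homeo homeomorphic_map_maps by blast
  have \<phi>: "continuous_map ?TA ?TB \<phi>" and \<psi>: "continuous_map ?TB ?TA \<psi>"
    and \<psi>\<phi>: "\<And>x. x \<in> A \<Longrightarrow> \<psi> (\<phi> x) = x" and \<phi>\<psi>: "\<And>y. y \<in> B \<Longrightarrow> \<phi> (\<psi> y) = y"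
    using maps tops unfolding homeomorphic_maps_def by auto
  have \<phi>B: "\<phi> x \<in> B" if "x \<in> A" for x
    using continuous_map_image_subset_topspace[OF \<phi>] that tops by auto
  have \<psi>A: "\<psi> y \<in> A" if "y \<in> B" for y
    using continuous_map_image_subset_topspace[OF \<psi>] that tops by auto
  have \<phi>0: "\<phi> 0 = 0" using hom[OF A0, of 0] zero[of 0] by simp
  have \<psi>0: "\<psi> 0 = 0" using \<psi>\<phi>[OF A0] \<phi>0 by simp
  have \<psi>hom: "\<psi> (seq_scale c y) = ?sc c (\<psi> y)" if "y \<in> B" for c y
    using hom[OF \<psi>A[OF that], of c] \<psi>\<phi>[OF Asc[OF \<psi>A[OF that]], of c] \<phi>\<psi>[OF that] by simp
  obtain F C where F: "finite F" "F \<subseteq> range op_norm" "0 < C"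
    "\<And>x. x \<in> A \<Longrightarrow> s_norm q (\<phi> x) \<le> C * (\<Sum>p\<in>F. p x)"
  proof (rule continuous_homogeneous_bound[OF \<phi>, where sc="?sc" and sc'=seq_scale and q="s_norm q"])
    show "\<forall>p\<in>range op_norm. \<forall>x\<in>A. 0 \<le> p x \<and> (\<forall>c. p (?sc c x) = cmod c * p x)"
      using op_norm_scale[OF subsetD[OF AX]] op_norm_nonneg[OF subsetD[OF AX]] by simp
    show "\<And>c x. x \<in> A \<Longrightarrow> ?sc c x \<in> A" by (rule Asc)
    show "\<And>c x. x \<in> A \<Longrightarrow> \<phi> (?sc c x) = seq_scale c (\<phi> x)" by (rule hom)
    show "0 \<in> A" by (rule A0)
    show "A \<subseteq> smooth_ops" by (rule AX)
    show "\<phi> 0 = 0" by (rule \<phi>0)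
  qed (simp_all add: s_norm_tri s_scale)
  obtain p where p: "\<forall>x. mono (\<lambda>q. op_norm q x) \<longrightarrow> (\<Sum>p\<in>F. p x) \<le> real (card F) * op_norm p x"
    using finite_sum_le_graded[OF F(1,2)] ..
  have "s_norm q (\<phi> x) \<le> (C * real (card F)) * op_norm p x" if x: "x \<in> A" for x
  proof -
    have "mono (\<lambda>q. op_norm q x)" by (intro monoI op_norm_mono subsetD[OF AX x])
    then have "C * (\<Sum>p\<in>F. p x) \<le> C * (real (card F) * op_norm p x)"
      using p F(3) by (intro mult_left_mono) auto
    then show ?thesis using F(4)[OF x] by (simp add: mult.assoc)
  qed
  then show "\<exists>p C. 0 \<le> C \<and> (\<forall>x\<in>A. s_norm q (\<phi> x) \<le> C * op_norm p x)"
    using F(3) by (intro exI[of _ p] exI[of _ "C * real (card F)"]) auto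
  show "\<exists>r D. 0 \<le> D \<and> (\<forall>x\<in>A. op_norm t x \<le> D * s_norm r (\<phi> x))"
  proof -
    obtain G E where G: "finite G" "G \<subseteq> range s_norm" "0 < E"
      "\<And>y. y \<in> B \<Longrightarrow> op_norm t (\<psi> y) \<le> E * (\<Sum>p\<in>G. p y)"
    proof (rule continuous_homogeneous_bound[OF \<psi>, where sc=seq_scale and sc'="?sc" and q="op_norm t"])
      show "\<forall>p\<in>range s_norm. \<forall>y\<in>B. 0 \<le> p y \<and> (\<forall>c. p (seq_scale c y) = cmod c * p y)"
        using s_scale(2)[OF subsetD[OF BY]] s_norm_nonneg[OF subsetD[OF BY]] by simp
      show "\<And>c y. y \<in> B \<Longrightarrow> seq_scale c y \<in> B" by (rule Bsc)
      show "\<And>c y. y \<in> B \<Longrightarrow> \<psi> (seq_scale c y) = ?sc c (\<psi> y)" by (rule \<psi>hom)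
      show "0 \<in> B" by (rule B0)
      show "B \<subseteq> s_space" by (rule BY)
      show "\<psi> 0 = 0" by (rule \<psi>0)
    qed (simp_all add: op_norm_tri op_norm_scale)
    obtain r where r: "\<forall>y. mono (\<lambda>q. s_norm q y) \<longrightarrow> (\<Sum>p\<in>G. p y) \<le> real (card G) * s_norm r y"
      using finite_sum_le_graded[OF G(1,2)] ..
    have "op_norm t x \<le> (E * real (card G)) * s_norm r (\<phi> x)" if x: "x \<in> A" for x
    proof -
      have "mono (\<lambda>q. s_norm q (\<phi> x))" by (intro monoI s_norm_mono subsetD[OF BY \<phi>B[OF x]])
      then have "E * (\<Sum>p\<in>G. p (\<phi> x)) \<le> E * (real (card G) * s_norm r (\<phi> x))"
        using r G(3) by (intro mult_left_mono) auto
      then show ?thesis using G(4)[OF \<phi>B[OF x]] \<psi>\<phi>[OF x] by (simp add: mult.assoc)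
    qed
    then show ?thesis using G(3) by (intro exI[of _ r] exI[of _ "E * real (card G)"]) auto
  qed
qed

section \<open>A commutative algebra of smooth operators outside s\<close>

theorem theorem6p10:
  "\<exists>A. closed_star_subalgebra smooth_op_algebra A \<and>
       commutative_algebra (restrict_algebra smooth_op_algebra A) \<and>
       \<not> (\<exists>B. closed_star_subalgebra s_algebra B \<and>
             top_star_isomorphic (restrict_algebra smooth_op_algebra A)
                                 (restrict_algebra s_algebra B))"
proof -
  define S where "S = range test_projection"
  define A where "A = commutant (commutant S)"
  have S: "S \<subseteq> smooth_ops" using test_projection_smooth by (auto simp: S_def)
  have S_star: "op_adjoint y \<in> S" if "y \<in> S" for y
    using that rank_one_self_adjoint[OF test_vector_s] by (auto simp: S_def test_projection_def)
  have S_comm: "x \<circ> y = y \<circ> x" if "x \<in> S" "y \<in> S" for x y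
  proof -
    obtain k l where kl: "x = test_projection k" "y = test_projection l" using \<open>x \<in> S\<close> \<open>y \<in> S\<close> by (auto simp: S_def)
    show ?thesis
    proof (cases "k = l")
      case False
      then show ?thesis
        unfolding kl test_projection_def
        by (simp add: rank_one_orthogonal[OF test_vector_s test_vector_s test_vector_orthogonal])
    qed (simp add: kl)
  qed
  have A: "closed_star_subalgebra smooth_op_algebra A"
    unfolding A_def
  proof (rule closed_star_subalgebra_commutant)
    show "commutant S \<subseteq> smooth_ops" by (auto simp: commutant_def)
  qed (rule commutant_star[OF S S_star])
  moreover have "commutative_algebra (restrict_algebra smooth_op_algebra A)"
    using bicommutant_commutative[OF S S_comm]
    by (auto simp: commutative_algebra_def restrict_algebra_def smooth_op_algebra_def A_def)
  moreover have False
    if B: "closed_star_subalgebra s_algebra B"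
      and iso: "top_star_isomorphism (restrict_algebra smooth_op_algebra A) (restrict_algebra s_algebra B) \<phi>" for B \<phi>
  proof -
    have AX: "A \<subseteq> smooth_ops" by (auto simp: A_def commutant_def)
    have PA: "test_projection k \<in> A" for k
      using subset_bicommutant[OF S] by (auto simp: A_def S_def)
    obtain p C where C: "0 \<le> C" "\<And>x. x \<in> A \<Longrightarrow> s_norm 1 (\<phi> x) \<le> C * op_norm p x"
      using isomorphism_bounds(1)[OF A B iso, of 1] by auto
    obtain r D where D: "0 \<le> D" "\<And>x. x \<in> A \<Longrightarrow> op_norm (Suc p) x \<le> D * s_norm r (\<phi> x)"
      using isomorphism_bounds(2)[OF A B iso, of "Suc p"] by auto
    have "op_norm (Suc p) (test_projection k) \<le> D * (C * op_norm p (test_projection k)) ^ max 1 r" for k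
    proof -
      define e where "e = \<phi> (test_projection k)"
      have "\<phi> ` topspace (topo (restrict_algebra smooth_op_algebra A)) = topspace (topo (restrict_algebra s_algebra B))"
        using iso homeomorphic_imp_surjective_map unfolding top_star_isomorphism_def by blast
      then have e: "e \<in> s_space"
        using PA[of k] AX by (auto simp: restrict_algebra_def smooth_op_algebra_def s_algebra_def s_topology_def e_def)
      have "\<phi> (test_projection k \<circ> test_projection k) = e * e"
        using iso PA[of k] AX unfolding top_star_isomorphism_def restrict_algebra_def smooth_op_algebra_def s_algebra_def e_def
        by auto
      then have idem: "e * e = e" by (simp add: test_projection_idempotent e_def)
      have "op_norm (Suc p) (test_projection k) \<le> D * s_norm r e" using D(2)[OF PA] by (simp add: e_def)
      \<comment> \<open>The estimate for idempotents fails for exponent 0, hence the maximum.\<close>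
      also have "\<dots> \<le> D * s_norm (max 1 r) e" by (intro mult_left_mono s_norm_mono e D) simp
      also have "\<dots> \<le> D * s_norm 1 e ^ max 1 r" by (intro mult_left_mono s_idempotent_norm e idem D) simp
      also have "\<dots> \<le> D * (C * op_norm p (test_projection k)) ^ max 1 r"
        using C(2)[OF PA, of k] by (intro mult_left_mono power_mono D s_norm_nonneg e) (simp add: e_def)
      finally show ?thesis .
    qed
    then show False using test_projection_not_tame[OF C(1) D(1)] by blast
  qed
  ultimately show ?thesis unfolding top_star_isomorphic_def by blast
qed

end
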